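(* Let $k$ be an algebraically closed field of characteristic $0$, and let $E$ be an elliptic curve over the function field $K$ of a smooth curve $C$ over $k$, with Weierstrass equation $y^2=x^3+Ax+B$, $A,B\in K$. Let $p\in C$ be a closed point such that $A$ and $B$ are regular at $p$ and such that the reduced equation defines a singular curve over $k$ with a node: $$y^2=x^3+A(p)x+B(p)=(x-\lambda_1)(x-\lambda_2)^2\quad\text{with }\lambda_1\neq\lambda_2 .$$ Then for every integer $n\ge 2$, the point of $\mathbb{P}^{2n^2+1}(k)$ defined by the reduction at $p$ of the associated Latt\`es map $\varphi_n$ (in the coordinate $x$) is not GIT semi-stable with respect to the conjugation action of $\mathrm{PGL}_2$.
   Context: Latt\`es map: $\varphi_n:\mathbb{P}^1_K\to\mathbb{P}^1_K$ is the degree $n^2$ map such that $x([n]Q)=\varphi_n(x(Q))$ for $Q\in E$, where $[n]$ is multiplication by $n$ on $E$; e.g. $\varphi_2(x)=\frac{P'(x)^2-8xP(x)}{4P(x)}$ with $P(x)=x^3+Ax+B$. Reduction: write $\varphi_n=[F_{\mathbf a}:F_{\mathbf b}]$ with $F_{\mathbf a}=\sum a_iX^{d-i}Y^i$, $F_{\mathbf b}=\sum b_iX^{d-i}Y^i$ homogeneous of degree $d=n^2$ in coordinates $[X,Y]$ with $x=X/Y$, having coefficients in $\mathcal{O}_{C,p}$ with at least one a unit; the reduction at $p$ is the point $[a_0(p),\dots,a_d(p),b_0(p),\dots,b_d(p)]\in\mathbb{P}^{2d+1}(k)$. Semi-stability: $\Gamma=\begin{pmatrix}\alpha&\beta\\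 \gamma&\delta\end{pmatrix}$ acts on pairs of forms by $(F_{\mathbf a},F_{\mathbf b})\mapsto \begin{pmatrix}\delta&-\beta\\-\gamma&\alpha\end{pmatrix}\big(F_{\mathbf a}(\alpha X+\beta Y,\gamma X+\delta Y),F_{\mathbf b}(\alpha X+\beta Y,\gamma X+\delta Y)\big)^T$, inducing the conjugation action on $\mathbb{P}^{2d+1}(k)$. A point of $\mathbb{P}^{2d+1}(k)$ is not semi-stable (unstable) if and only if it is $\mathrm{SL}_2(k)$-conjugate to a point with $a_i=0$ for all $i\le\frac{d-1}{2}$ and $b_j=0$ for all $j\le\frac{d+1}{2}$. *)

theory Defs
  imports
    "HOL-Computational_Algebra.Computational_Algebra"
    "HOL-Algebra.Algebraic_Closure_Type"
begin

section \<open>Function fields and smooth curves\<close>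

definition field_embedding :: "('k::field \<Rightarrow> 'f::field) \<Rightarrow> bool" where
  "field_embedding \<iota> \<longleftrightarrow>
     \<iota> 1 = 1 \<and> (\<forall>x y. \<iota> (x + y) = \<iota> x + \<iota> y) \<and> (\<forall>x y. \<iota> (x * y) = \<iota> x * \<iota> y)"

definition transcendental_over :: "('k::field \<Rightarrow> 'f::field) \<Rightarrow> 'f \<Rightarrow> bool" where
  "transcendental_over \<iota> t \<longleftrightarrow> (\<forall>P. poly (map_poly \<iota> P) t = 0 \<longrightarrow> P = 0)"

definition simple_ext :: "('k::field \<Rightarrow> 'f::field) \<Rightarrow> 'f \<Rightarrow> 'f set" where
  "simple_ext \<iota> t =
     {poly (map_poly \<iota> P) t / poly (map_poly \<iota> Q) t | P Q. poly (map_poly \<iota> Q) t \<noteq> 0}"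

text \<open>
  The whole type \<open>'f\<close> is a function field in one variable over \<open>k\<close>, embedded by \<open>\<iota>\<close>: a finite
  extension of \<open>k(t)\<close> for some transcendental \<open>t\<close>.
\<close>

definition function_field :: "('k::field \<Rightarrow> 'f::field) \<Rightarrow> bool" where
  "function_field \<iota> \<longleftrightarrow> field_embedding \<iota> \<and>
     (\<exists>t. transcendental_over \<iota> t \<and>
        (\<exists>S. finite S \<and>
           (\<forall>f. \<exists>c. (\<forall>s\<in>S. c s \<in> simple_ext \<iota> t) \<and> f = (\<Sum>s\<in>S. c s * s))))"

text \<open>
  The discrete valuation rings of \<open>K/k\<close>, given by their normalised valuations \<open>ord\<close>.  As \<open>ord\<close>
  takes integer values, \<open>ord 0\<close> carries no information; it is fixed to be 0 so that distinct
  functions are distinct valuations.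
\<close>

definition places :: "('k::field \<Rightarrow> 'f::field) \<Rightarrow> ('f \<Rightarrow> int) set" where
  "places \<iota> = {v. v 0 = 0 \<and>
     (\<forall>f g. f \<noteq> 0 \<longrightarrow> g \<noteq> 0 \<longrightarrow> v (f * g) = v f + v g) \<and>
     (\<forall>f g. f \<noteq> 0 \<longrightarrow> g \<noteq> 0 \<longrightarrow> f + g \<noteq> 0 \<longrightarrow> min (v f) (v g) \<le> v (f + g)) \<and>
     (\<forall>c. c \<noteq> 0 \<longrightarrow> v (\<iota> c) = 0) \<and>
     (\<exists>f. f \<noteq> 0 \<and> v f = 1)}"

text \<open>
  Smooth curves over an algebraically closed field \<open>k\<close> with function field \<open>K\<close>, as abstract
  nonsingular curves (Hartshorne, Section I.6): the closed points are discrete valuation rings of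
  \<open>K/k\<close>, and a curve is an open, i.e. cofinite, set of them.  The local ring of the curve at \<open>p\<close>
  is the valuation ring \<open>p\<close> itself.
\<close>

definition smooth_curve :: "('k::alg_closed_field \<Rightarrow> 'f::field) \<Rightarrow> ('f \<Rightarrow> int) set \<Rightarrow> bool" where
  "smooth_curve \<iota> C \<longleftrightarrow> function_field \<iota> \<and> C \<subseteq> places \<iota> \<and> finite (places \<iota> - C)"

definition local_ring :: "('f::field \<Rightarrow> int) \<Rightarrow> 'f set" where
  "local_ring p = {f. f = 0 \<or> p f \<ge> 0}"

definition maximal_ideal :: "('f::field \<Rightarrow> int) \<Rightarrow> 'f set" where
  "maximal_ideal p = {f. f = 0 \<or> p f > 0}"

definition local_units :: "('f::field \<Rightarrow> int) \<Rightarrow> 'f set" where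
  "local_units p = {f. f \<noteq> 0 \<and> p f = 0}"

text \<open>
  The value \<open>f(p)\<close> of a function regular at \<open>p\<close>.  It exists because the residue field at a closed
  point is \<open>k\<close>, which is algebraically closed.
\<close>

definition value_at :: "('k::field \<Rightarrow> 'f::field) \<Rightarrow> ('f \<Rightarrow> int) \<Rightarrow> 'f \<Rightarrow> 'k" where
  "value_at \<iota> p f = (THE c. f - \<iota> c \<in> maximal_ideal p)"


section \<open>Elliptic curves in short Weierstrass form\<close>

definition elliptic_curve :: "'f::field \<Rightarrow> 'f \<Rightarrow> bool" where
  "elliptic_curve A B \<longleftrightarrow> 4 * A ^ 3 + 27 * B ^ 2 \<noteq> 0"

datatype 'a ec_point = Infinity | Affine 'a 'a

definition ec_points :: "'a::field \<Rightarrow> 'a \<Rightarrow> 'a ec_point set" where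
  "ec_points A B = {Infinity} \<union> {Affine x y | x y. y ^ 2 = x ^ 3 + A * x + B}"

fun ec_add :: "'a::field \<Rightarrow> 'a ec_point \<Rightarrow> 'a ec_point \<Rightarrow> 'a ec_point" where
  "ec_add A Infinity Q = Q"
| "ec_add A P Infinity = P"
| "ec_add A (Affine x1 y1) (Affine x2 y2) =
     (if x1 = x2 \<and> y1 = - y2 then Infinity
      else let m = (if x1 = x2 then (3 * x1 ^ 2 + A) / (2 * y1) else (y2 - y1) / (x2 - x1));
               x3 = m ^ 2 - x1 - x2
           in Affine x3 (m * (x1 - x3) - y1))"

definition ec_mult :: "'a::field \<Rightarrow> nat \<Rightarrow> 'a ec_point \<Rightarrow> 'a ec_point" where
  "ec_mult A n Q = ((ec_add A Q) ^^ n) Infinity"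

text \<open>Homogeneous coordinates \<open>[X, Y]\<close> of the image in the projective line, with \<open>x = X/Y\<close>.\<close>

fun ec_x :: "'a::field ec_point \<Rightarrow> 'a \<times> 'a" where
  "ec_x Infinity = (1, 0)"
| "ec_x (Affine x y) = (x, 1)"


section \<open>Pairs of binary forms and the Lattes maps\<close>

text \<open>
  A binary form \<open>F\<^sub>a = \<Sum> a\<^sub>i X\<^bsup>d-i\<^esup> Y\<^bsup>i\<^esup>\<close> of degree \<open>d\<close> is given by its coefficients \<open>a 0, \<dots>, a d\<close>; the values of \<open>a\<close> at
  larger arguments are irrelevant in everything below.
\<close>

definition form_eval :: "nat \<Rightarrow> (nat \<Rightarrow> 'a::comm_ring_1) \<Rightarrow> 'a \<Rightarrow> 'a \<Rightarrow> 'a" where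
  "form_eval d a u v = (\<Sum>i\<le>d. a i * u ^ (d - i) * v ^ i)"

text \<open>
  \<open>[F\<^sub>a : F\<^sub>b]\<close> is a morphism of degree \<open>d\<close> from the projective line over \<open>K\<close> to itself:
  the forms have no common zero over the algebraic closure.
\<close>

definition P1_morphism :: "nat \<Rightarrow> (nat \<Rightarrow> 'f::field) \<Rightarrow> (nat \<Rightarrow> 'f) \<Rightarrow> bool" where
  "P1_morphism d a b \<longleftrightarrow>
     (\<forall>u v :: 'f alg_closure. (u, v) \<noteq> (0, 0) \<longrightarrow>
        (form_eval d (\<lambda>i. to_ac (a i)) u v, form_eval d (\<lambda>i. to_ac (b i)) u v) \<noteq> (0, 0))"

text \<open>
  \<open>[F\<^sub>a : F\<^sub>b]\<close> is the Lattes map of degree \<open>n\<^sup>2\<close>.  The points \<open>Q\<close> are geometric points, since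
  the rational points of \<open>E\<close> need not determine the map.
\<close>

definition is_lattes_map ::
    "'f::field \<Rightarrow> 'f \<Rightarrow> nat \<Rightarrow> (nat \<Rightarrow> 'f) \<Rightarrow> (nat \<Rightarrow> 'f) \<Rightarrow> bool" where
  "is_lattes_map A B n a b \<longleftrightarrow> P1_morphism (n ^ 2) a b \<and>
     (\<forall>Q \<in> ec_points (to_ac A) (to_ac B).
        let (u, v) = ec_x Q; (u', v') = ec_x (ec_mult (to_ac A) n Q)
        in \<exists>c. c \<noteq> 0 \<and>
             form_eval (n ^ 2) (\<lambda>i. to_ac (a i)) u v = c * u' \<and>
             form_eval (n ^ 2) (\<lambda>i. to_ac (b i)) u v = c * v')"

definition normalised_at ::
    "('f::field \<Rightarrow> int) \<Rightarrow> nat \<Rightarrow> (nat \<Rightarrow> 'f) \<Rightarrow> (nat \<Rightarrow> 'f) \<Rightarrow> bool" where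
  "normalised_at p d a b \<longleftrightarrow>
     (\<forall>i\<le>d. a i \<in> local_ring p \<and> b i \<in> local_ring p) \<and>
     (\<exists>i\<le>d. a i \<in> local_units p \<or> b i \<in> local_units p)"


section \<open>Semi-stability for the conjugation action\<close>

text \<open>
  Coefficients of \<open>F(\<alpha> X + \<beta> Y, \<gamma> X + \<delta> Y)\<close>, read off after setting \<open>X = 1\<close>: the coefficient of
  \<open>X\<^bsup>d-i\<^esup> Y\<^bsup>i\<^esup>\<close> becomes that of the \<open>i\<close>-th power of the indeterminate.
\<close>

definition form_subst ::
    "nat \<Rightarrow> 'a \<Rightarrow> 'a \<Rightarrow> 'a \<Rightarrow> 'a \<Rightarrow> (nat \<Rightarrow> 'a::comm_ring_1) \<Rightarrow> nat \<Rightarrow> 'a" where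
  "form_subst d \<alpha> \<beta> \<gamma> \<delta> a i =
     Polynomial.coeff (\<Sum>j\<le>d. smult (a j) ([:\<alpha>, \<beta>:] ^ (d - j) * [:\<gamma>, \<delta>:] ^ j)) i"

definition conj_act ::
    "nat \<Rightarrow> 'a \<Rightarrow> 'a \<Rightarrow> 'a \<Rightarrow> 'a \<Rightarrow> (nat \<Rightarrow> 'a::comm_ring_1) \<times> (nat \<Rightarrow> 'a) \<Rightarrow>
     (nat \<Rightarrow> 'a) \<times> (nat \<Rightarrow> 'a)" where
  "conj_act d \<alpha> \<beta> \<gamma> \<delta> = (\<lambda>(a, b).
     let a' = form_subst d \<alpha> \<beta> \<gamma> \<delta> a; b' = form_subst d \<alpha> \<beta> \<gamma> \<delta> b
     in (\<lambda>i. \<delta> * a' i - \<beta> * b' i, \<lambda>i. - \<gamma> * a' i + \<alpha> * b' i))"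

text \<open>
  Homogeneous polynomials of degree \<open>m\<close> in the coordinates \<open>a\<^sub>0, \<dots>, a\<^sub>d, b\<^sub>0, \<dots>, b\<^sub>d\<close>, as
  functions (over an infinite field these are the same as formal polynomials).
\<close>

definition hom_polynomial ::
    "nat \<Rightarrow> nat \<Rightarrow> ((nat \<Rightarrow> 'a::comm_ring_1) \<times> (nat \<Rightarrow> 'a) \<Rightarrow> 'a) \<Rightarrow> bool" where
  "hom_polynomial d m f \<longleftrightarrow>
     (\<exists>(M :: ((nat \<Rightarrow> nat) \<times> (nat \<Rightarrow> nat)) set) c. finite M \<and>
        (\<forall>(e, e') \<in> M. (\<Sum>i\<le>d. e i + e' i) = m) \<and>
        (\<forall>a b. f (a, b) = (\<Sum>(e, e')\<in>M. c (e, e') * (\<Prod>i\<le>d. a i ^ e i * b i ^ e' i))))"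

text \<open>
  Mumford's definition: the point \<open>[a\<^sub>0, \<dots>, a\<^sub>d, b\<^sub>0, \<dots>, b\<^sub>d]\<close> of projective space is semi-stable
  if some invariant form of positive degree does not vanish there.  As usual the action of the
  projective linear group is linearised through the special linear group.  The condition is
  invariant under scaling \<open>(a, b)\<close>, as \<open>f\<close> is homogeneous.
\<close>

definition semistable :: "nat \<Rightarrow> (nat \<Rightarrow> 'k::field) \<times> (nat \<Rightarrow> 'k) \<Rightarrow> bool" where
  "semistable d P \<longleftrightarrow>
     (\<exists>m f. m > 0 \<and> hom_polynomial d m f \<and>
        (\<forall>\<alpha> \<beta> \<gamma> \<delta> R. \<alpha> * \<delta> - \<beta> * \<gamma> = 1 \<longrightarrow> f (conj_act d \<alpha> \<beta> \<gamma> \<delta> R) = f R) \<and>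
        f P \<noteq> 0)"

end

theory Submission
  imports Defs
begin

text \<open>
  Put \<open>z = x - \<lambda>\<^sub>2\<close>.  Then \<open>z \<circ> [m]\<close> is a quotient of two coprime polynomials in \<open>z\<close>, which the
  addition formulas determine recursively: numerators at \<open>m + 1\<close> and \<open>m - 1\<close> have a known
  product, and so do denominators.  At \<open>p\<close> the node is \<open>z = 0\<close>, and these product formulas
  reduce so far that induction yields \<open>z ^ m\<^sup>2\<close> for the numerator and order exactly \<open>m (m - 1)\<close> at
  \<open>z = 0\<close> for the denominator.  By Gauss's lemma the normalised forms of the Lattes map are these
  two polynomials up to an integral constant.  Hence both reduced forms vanish at the node to an order
  that makes them unstable for the one-parameter subgroup fixing it, by Mumford's criterion.
\<close>

section \<open>Places of function fields and their residue fields\<close>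

text \<open>The orders have a geometric origin. The smooth part of the reduced curve
  \<open>y^2 = z^2 (z + \<mu>)\<close> is a multiplicative group with coordinate s,
  \<open>z = 4 \<mu> s / (1 - s)^2\<close>, and multiplication by m sends s to \<open>s^m\<close>.
  So the reduced map has degree m and vanishes at the node to order m only; polynomials of degree up
  to \<open>m^2\<close> representing it acquire the common factor \<open>z^(m^2 - m)\<close>. The
  recursion reproduces exactly these orders. Instability then comes down to
  \<open>n (n - 1) > (n^2 - 1) / 2\<close>, that is \<open>(n - 1)^2 > 0\<close>.

  Two obstacles shape the proof. Numerator and denominator are coprime over K but not after
  reduction, so exact divisibility is established over K and only the resulting identities are
  reduced. And a closed point is given as a bare valuation, so a regular function has a value in k
  only once the residue field is known to be k; this is a transcendence degree argument.\<close>

locale embedded_field =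
  fixes \<iota> :: "'k::field \<Rightarrow> 'f::field"
  assumes embedding: "field_embedding \<iota>"
begin

lemma emb_1 [simp]: "\<iota> 1 = 1"
  and emb_add [simp]: "\<iota> (x + y) = \<iota> x + \<iota> y"
  and emb_mult [simp]: "\<iota> (x * y) = \<iota> x * \<iota> y"
  using embedding by (auto simp: field_embedding_def)

lemma emb_0 [simp]: "\<iota> 0 = 0"
  by (metis add_0 add_cancel_right_left embedding field_embedding_def)

lemma emb_minus [simp]: "\<iota> (- x) = - \<iota> x"
  using emb_add[of x "- x"] by (simp add: eq_neg_iff_add_eq_0 add.commute)

lemma emb_diff [simp]: "\<iota> (x - y) = \<iota> x - \<iota> y"
  using emb_add[of x "- y"] by simp

lemma emb_eq_0_iff [simp]: "\<iota> x = 0 \<longleftrightarrow> x = 0"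
proof
  assume "\<iota> x = 0"
  then have "\<iota> (x * inverse x) = 0" by simp
  then show "x = 0" by (cases "x = 0") auto
qed simp

lemma emb_of_nat [simp]: "\<iota> (of_nat n) = of_nat n"
  by (induction n) simp_all

lemma emb_numeral [simp]: "\<iota> (numeral n) = numeral n"
  using emb_of_nat[of "numeral n"] by (simp del: emb_of_nat)

definition ev :: "'f \<Rightarrow> 'k poly \<Rightarrow> 'f" where
  "ev x P = poly (map_poly \<iota> P) x"

lemma ev_0 [simp]: "ev x 0 = 0"
  by (simp add: ev_def)

lemma ev_pCons [simp]: "ev x (pCons c P) = \<iota> c + x * ev x P"
  by (simp add: ev_def map_poly_pCons)

lemma ev_1 [simp]: "ev x 1 = 1"
  by (simp add: one_pCons)

lemma ev_add [simp]: "ev x (P + Q) = ev x P + ev x Q"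
  by (induction P Q rule: poly_induct2) (simp_all add: algebra_simps)

lemma ev_smult [simp]: "ev x (smult c P) = \<iota> c * ev x P"
  by (induction P) (simp_all add: algebra_simps)

lemma ev_mult [simp]: "ev x (P * Q) = ev x P * ev x Q"
  by (induction P) (simp_all add: algebra_simps)

lemma ev_diff [simp]: "ev x (P - Q) = ev x P - ev x Q"
  using ev_add[of x "P - Q" Q] by (simp del: ev_add)

lemma ev_power [simp]: "ev x (P ^ n) = ev x P ^ n"
  by (induction n) simp_all

lemma ev_numeral [simp]: "ev x (numeral n) = numeral n"
  by (simp add: numeral_poly)

lemma ev_pcompose: "ev x (pcompose P Q) = ev (ev x Q) P"
  by (induction P) (simp_all add: pcompose_pCons)

lemma ev_prod: "ev x (\<Prod>i\<in>S. P i) = (\<Prod>i\<in>S. ev x (P i))"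
  by (induction S rule: infinite_finite_induct) simp_all

lemma ev_sum: "ev x (\<Sum>i\<in>S. P i) = (\<Sum>i\<in>S. ev x (P i))"
  by (induction S rule: infinite_finite_induct) simp_all

lemma ev_monom [simp]: "ev x (monom c n) = \<iota> c * x ^ n"
  by (induction n) (simp_all add: monom_0 monom_Suc algebra_simps)

sublocale vs: vector_space "\<lambda>c x. \<iota> c * x"
  by unfold_locales (simp_all add: algebra_simps)

end

section \<open>The valuation ring of a place and its residue field\<close>

locale curve_place = embedded_field \<iota> for \<iota> :: "'k::alg_closed_field \<Rightarrow> 'f::field" +
  fixes p :: "'f \<Rightarrow> int"
  assumes place: "p \<in> places \<iota>"
begin

lemma val_0 [simp]: "p 0 = 0"
  and val_mult: "f \<noteq> 0 \<Longrightarrow> g \<noteq> 0 \<Longrightarrow> p (f * g) = p f + p g"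
  and val_add: "f \<noteq> 0 \<Longrightarrow> g \<noteq> 0 \<Longrightarrow> f + g \<noteq> 0 \<Longrightarrow> min (p f) (p g) \<le> p (f + g)"
  and val_const [simp]: "p (\<iota> c) = 0"
  using place by (cases "c = 0"; auto simp: places_def)+

lemma uniformizer: obtains u where "u \<noteq> 0" "p u = 1"
  using place by (auto simp: places_def)

lemma val_1 [simp]: "p 1 = 0"
  using val_const[of 1] by simp

lemma val_minus [simp]: "p (- f) = p f"
proof (cases "f = 0")
  case False
  have "p (\<iota> (- 1) * f) = p (\<iota> (- 1)) + p f"
    using False by (intro val_mult) (auto simp del: emb_minus)
  then show ?thesis using val_const[of "- 1"] by simp
qed simp

lemma val_power: "f \<noteq> 0 \<Longrightarrow> p (f ^ n) = int n * p f"
  by (induction n) (simp_all add: val_mult algebra_simps)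

lemma val_inverse: "f \<noteq> 0 \<Longrightarrow> p (inverse f) = - p f"
  using val_mult[of f "inverse f"] by simp

abbreviation R where "R \<equiv> local_ring p"
abbreviation \<mm> where "\<mm> \<equiv> maximal_ideal p"

lemma R_add: "f \<in> R \<Longrightarrow> g \<in> R \<Longrightarrow> f + g \<in> R"
  using val_add[of f g] unfolding local_ring_def by (cases "f + g = 0"; force)

lemma R_mult: "f \<in> R \<Longrightarrow> g \<in> R \<Longrightarrow> f * g \<in> R"
  using val_mult[of f g] unfolding local_ring_def by force

lemma R_emb [simp]: "\<iota> c \<in> R"
  by (simp add: local_ring_def)

lemma m_add: "f \<in> \<mm> \<Longrightarrow> g \<in> \<mm> \<Longrightarrow> f + g \<in> \<mm>"
  using val_add[of f g] unfolding maximal_ideal_def by (cases "f + g = 0"; force)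

lemma m_minus: "f \<in> \<mm> \<Longrightarrow> - f \<in> \<mm>"
  unfolding maximal_ideal_def by simp

lemma m_mult: "f \<in> \<mm> \<Longrightarrow> g \<in> R \<Longrightarrow> g * f \<in> \<mm>"
  using val_mult[of g f] unfolding maximal_ideal_def local_ring_def by force

lemma m_0 [simp]: "0 \<in> \<mm>"
  by (simp add: maximal_ideal_def)

lemma m_subset_R: "f \<in> \<mm> \<Longrightarrow> f \<in> R"
  unfolding maximal_ideal_def local_ring_def by auto

lemma emb_m_iff [simp]: "\<iota> c \<in> \<mm> \<longleftrightarrow> c = 0"
  by (simp add: maximal_ideal_def)

text \<open>A residue outside k is transcendental over k: as k is algebraically closed,
  \<open>P\<close> splits into linear factors, and each \<open>f - \<iota> c\<close> is a unit at
  p.\<close>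

lemma transcendental_unit:
  assumes f: "f \<in> R" and tr: "\<And>c. f - \<iota> c \<notin> \<mm>" and "P \<noteq> 0"
  shows "ev f P \<noteq> 0 \<and> p (ev f P) = 0"
  using \<open>P \<noteq> 0\<close>
proof (induction "degree P" arbitrary: P rule: less_induct)
  case less
  show ?case
  proof (cases "degree P = 0")
    case True
    then obtain c where "P = [:c:]" by (rule degree_eq_zeroE)
    then show ?thesis using less.prems by simp
  next
    case False
    then obtain c where "poly P c = 0"
      using alg_closed_imp_poly_has_root[of P] by auto
    then obtain Q where Q: "P = [:- c, 1:] * Q"
      unfolding poly_eq_0_iff_dvd by (elim dvdE)
    have "Q \<noteq> 0" using Q less.prems by auto
    moreover have "degree Q < degree P"
      using \<open>Q \<noteq> 0\<close> unfolding Q by (subst degree_mult_eq) auto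
    ultimately have IH: "ev f Q \<noteq> 0 \<and> p (ev f Q) = 0" by (intro less.hyps)
    have "f - \<iota> c \<in> R" using R_add[OF f R_emb[of "- c"]] by simp
    then have "f - \<iota> c \<noteq> 0 \<and> p (f - \<iota> c) = 0"
      using tr[of c] by (auto simp: maximal_ideal_def local_ring_def)
    moreover have "ev f P = (f - \<iota> c) * ev f Q" unfolding Q ev_mult by simp
    ultimately show ?thesis using IH by (simp add: val_mult)
  qed
qed

text \<open>Algebraic independence of \<open>f\<close> and a uniformizer \<open>u\<close>. Modulo
  the maximal ideal only the term without \<open>u\<close> survives; it vanishes by
  \<open>transcendental_unit\<close>, and then one power of \<open>u\<close> cancels.\<close>

lemma transcendental_expansion:
  assumes f: "f \<in> R" and tr: "\<And>c. f - \<iota> c \<notin> \<mm>" and u: "u \<noteq> 0" "p u = 1"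
    and "(\<Sum>j<N. ev f (P j) * u ^ j) = 0" and "j < N"
  shows "P j = 0"
  using assms(5,6)
proof (induction N arbitrary: P j)
  case (Suc N)
  have ev_R: "ev f Q \<in> R" for Q
    using transcendental_unit[OF f tr] by (cases "Q = 0") (auto simp: local_ring_def)
  have "(\<Sum>j<N. ev f (P (Suc j)) * u ^ j) \<in> R" for N
  proof (induction N)
    case (Suc N)
    have "u ^ N \<in> R" using u by (simp add: local_ring_def val_power)
    then show ?case using Suc by (auto intro!: R_add R_mult ev_R)
  qed (simp add: local_ring_def)
  moreover have "u \<in> \<mm>" using u by (simp add: maximal_ideal_def)
  ultimately have *: "- ((\<Sum>j<N. ev f (P (Suc j)) * u ^ j) * u) \<in> \<mm>"
    by (intro m_minus m_mult)
  have eq: "ev f (P 0) + (\<Sum>j<N. ev f (P (Suc j)) * u ^ j) * u = 0"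
    using Suc.prems(1)
    by (simp add: sum.lessThan_Suc_shift sum_distrib_left mult_ac del: sum.lessThan_Suc)
  then have "ev f (P 0) \<in> \<mm>" using * by (simp add: eq_neg_iff_add_eq_0[symmetric])
  then have P0: "P 0 = 0"
    by (cases "P 0 = 0") (use transcendental_unit[OF f tr, of "P 0"] in \<open>auto simp: maximal_ideal_def\<close>)
  then have "(\<Sum>j<N. ev f (P (Suc j)) * u ^ j) = 0" using eq u by simp
  with Suc.IH[of "\<lambda>j. P (Suc j)"] P0 Suc.prems(2) show ?case by (cases j) auto
qed simp

end

text \<open>\<open>q\<close> is a common denominator for multiplication by \<open>G\<close> on
  \<open>S\<close>. Keeping it as a factor leaves only the degree in \<open>t\<close> to be tracked,
  which grows by at most \<open>e\<close>.\<close>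

lemma (in embedded_field) span_product:
  assumes q: "\<And>s g. s \<in> S \<Longrightarrow> g \<in> G \<Longrightarrow> q * (g * s) \<in> vs.span {t ^ i * s | i s. i \<le> e \<and> s \<in> S}"
    and x: "x \<in> vs.span {t ^ i * s | i s. i \<le> l \<and> s \<in> S}" and "g \<in> G"
  shows "q * g * x \<in> vs.span {t ^ i * s | i s. i \<le> e + l \<and> s \<in> S}"
  using x
proof (induction rule: vs.span_induct_alt)
  case base
  then show ?case by (simp add: vs.span_zero)
next
  case (step c y z)
  then obtain i s where y: "y = t ^ i * s" "i \<le> l" "s \<in> S" by auto
  have "t ^ i * w \<in> vs.span {t ^ i * s | i s. i \<le> e + l \<and> s \<in> S}"
    if "w \<in> vs.span {t ^ i * s | i s. i \<le> e \<and> s \<in> S}" for w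
    using that
  proof (induction rule: vs.span_induct_alt)
    case base
    then show ?case by (simp add: vs.span_zero)
  next
    case (step c y' z')
    then obtain i' s' where y': "y' = t ^ i' * s'" "i' \<le> e" "s' \<in> S" by auto
    then have "t ^ i * y' \<in> {t ^ i * s | i s. i \<le> e + l \<and> s \<in> S}"
      using y(2) by (auto simp: power_add mult_ac intro!: exI[of _ "i + i'"])
    then have "\<iota> c * (t ^ i * y') + t ^ i * z' \<in> vs.span {t ^ i * s | i s. i \<le> e + l \<and> s \<in> S}"
      using step.IH by (intro vs.span_add vs.span_scale) (auto intro: vs.span_base)
    then show ?case by (simp add: algebra_simps)
  qed
  from this[OF q[OF y(3) \<open>g \<in> G\<close>]]
  have "\<iota> c * (t ^ i * (q * (g * s))) + q * g * z \<in> vs.span {t ^ i * s | i s. i \<le> e + l \<and> s \<in> S}"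
    using step.IH by (intro vs.span_add vs.span_scale)
  then show ?case by (simp add: y algebra_simps)
qed

text \<open>
  Multiplication by any of \<open>1, f, u\<close> raises the degree in \<open>t\<close> by at most \<open>e\<close>, after clearing a
  fixed denominator.  So the \<open>(M + 1)\<^sup>2\<close> monomials of degree at most \<open>M\<close> in each of \<open>f\<close> and \<open>u\<close>
  lie in a space of dimension linear in \<open>M\<close>.
\<close>

lemma (in embedded_field) monomials_dependent:
  assumes "finite S" and "q \<noteq> 0"
    and q1: "q \<in> vs.span {t ^ i * s | i s. i \<le> e \<and> s \<in> S}"
    and q: "\<And>s g. s \<in> S \<Longrightarrow> g \<in> {1, f, u} \<Longrightarrow>
      q * (g * s) \<in> vs.span {t ^ i * s | i s. i \<le> e \<and> s \<in> S}"
  shows "\<exists>M c. (\<exists>i\<le>M. \<exists>j\<le>M. c i j \<noteq> 0) \<and> (\<Sum>j\<le>M. \<Sum>i\<le>M. \<iota> (c i j) * f ^ i * u ^ j) = 0"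
proof (rule ccontr)
  assume *: "\<not> ?thesis"
  let ?W = "\<lambda>l. {t ^ i * s | i s. i \<le> l \<and> s \<in> S}"
  define V where "V n = vs.span (?W (n * e))" for n
  have V_Suc: "q * g * x \<in> V (Suc n)" if "x \<in> V n" "g \<in> {1, f, u}" for g x n
    using span_product[OF q that(1)[unfolded V_def] that(2)] by (simp add: V_def)
  \<comment> \<open>The first \<open>q\<close> enters through \<open>q1\<close>, and one more
    accompanies each multiplication. The \<open>k\<close> extra multiplications by 1 serve to give
    all monomials the same power of \<open>q\<close>.\<close>
  have W: "q ^ (1 + i + j + k) * f ^ i * u ^ j \<in> V (1 + i + j + k)" for i j k
  proof (induction k)
    case 0
    show ?case
    proof (induction j)
      case 0
      show ?case
      proof (induction i)
        case 0
        then show ?case using q1 by (simp add: V_def)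
      next
        case (Suc i)
        from V_Suc[OF Suc, of f] show ?case by (simp add: mult_ac)
      qed
    next
      case (Suc j)
      from V_Suc[OF Suc, of u] show ?case by (simp add: mult_ac)
    qed
  next
    case (Suc k)
    from V_Suc[OF Suc, of 1] show ?case by (simp add: mult_ac)
  qed
  \<comment> \<open>Chosen so that \<open>M / 2 = (e + 1) * (card S + 1)\<close>: the spanning set
    then has at most \<open>(1 + 2 * M) * (M / 2) = M^2 + M / 2\<close> elements, fewer than the
    \<open>(M + 1)^2\<close> monomials.\<close>
  define M where "M = 2 * (e + 1) * (card S + 1)"
  define m where "m = (\<lambda>(i, j). q ^ (1 + 2 * M) * f ^ i * u ^ j)"
  define I where "I = {..M} \<times> {..M}"
  have fin: "finite I" by (simp add: I_def)
  have indep: "c x = 0" if c: "(\<Sum>x\<in>I. \<iota> (c x) * m x) = 0" and "x \<in> I" for c x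
  proof -
    have "q ^ (1 + 2 * M) * (\<Sum>j\<le>M. \<Sum>i\<le>M. \<iota> (c (i, j)) * f ^ i * u ^ j) = (\<Sum>x\<in>I. \<iota> (c x) * m x)"
      unfolding I_def m_def
      by (subst sum.swap) (simp add: sum.cartesian_product sum_distrib_left mult_ac case_prod_unfold)
    then have "(\<Sum>j\<le>M. \<Sum>i\<le>M. \<iota> (c (i, j)) * f ^ i * u ^ j) = 0" using c \<open>q \<noteq> 0\<close> by simp
    with *[unfolded not_ex, THEN spec, THEN spec, of M "\<lambda>i j. c (i, j)"]
    have "\<forall>i\<le>M. \<forall>j\<le>M. c (i, j) = 0" by auto
    then show ?thesis using \<open>x \<in> I\<close> by (auto simp: I_def)
  qed
  \<comment> \<open>Two coinciding monomials would already be a relation, so the image has full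
    cardinality.\<close>
  have inj: "inj_on m I"
  proof (rule inj_onI, rule ccontr)
    fix x y assume xy: "x \<in> I" "y \<in> I" "m x = m y" "x \<noteq> y"
    let ?c = "\<lambda>z. (if z = x then 1 else 0) - (if z = y then 1 else 0)"
    have "(\<Sum>z\<in>I. \<iota> (?c z) * m z) = (\<Sum>z\<in>I. (if z = x then m z else 0) - (if z = y then m z else 0))"
      by (intro sum.cong) auto
    also have "\<dots> = 0" using xy fin by (simp add: sum_subtractf)
    finally show False using indep[of ?c x] xy by simp
  qed
  have "\<not> vs.dependent (m ` I)"
  proof
    assume "vs.dependent (m ` I)"
    then obtain c v where c: "(\<Sum>v\<in>m ` I. \<iota> (c v) * v) = 0" and v: "v \<in> m ` I" "c v \<noteq> 0"
      using vs.dependent_finite[of "m ` I"] fin by auto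
    from c have "(\<Sum>x\<in>I. \<iota> (c (m x)) * m x) = 0"
      using inj by (simp add: sum.reindex)
    then show False using indep[of "\<lambda>x. c (m x)"] v by auto
  qed
  moreover have "m ` I \<subseteq> V (1 + 2 * M)"
  proof
    fix x assume "x \<in> m ` I"
    then obtain i j where ij: "i \<le> M" "j \<le> M" "x = q ^ (1 + 2 * M) * f ^ i * u ^ j"
      by (auto simp: m_def I_def)
    then have "1 + i + j + (2 * M - i - j) = 1 + 2 * M" by simp
    then show "x \<in> V (1 + 2 * M)"
      using W[of i j "2 * M - i - j"] ij(3) by simp
  qed
  moreover have Weq: "?W l = (\<lambda>(i, s). t ^ i * s) ` ({..l} \<times> S)" for l
    by force
  ultimately have "card (m ` I) \<le> card (?W ((1 + 2 * M) * e))"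
    using vs.independent_span_bound[of "?W ((1 + 2 * M) * e)" "m ` I"] \<open>finite S\<close>
    by (simp add: V_def)
  also have "\<dots> \<le> ((1 + 2 * M) * e + 1) * card S"
    unfolding Weq using card_image_le[of "{..(1 + 2 * M) * e} \<times> S" "\<lambda>(i, s). t ^ i * s"] \<open>finite S\<close>
    by simp
  also have "\<dots> \<le> ((1 + 2 * M) * (e + 1)) * (card S + 1)"
    by (intro mult_mono) auto
  also have "\<dots> = (1 + 2 * M) * ((e + 1) * (card S + 1))" by (simp only: mult.assoc)
  also have "card (m ` I) = (M + 1) * (M + 1)"
    using inj by (simp add: card_image I_def)
  finally have "(M + 1) * (M + 1) \<le> (1 + 2 * M) * ((e + 1) * (card S + 1))" .
  moreover have "(M + 1) * (M + 1) > (1 + 2 * M) * (M div 2)"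
  proof -
    have "2 * (M div 2) \<le> M" by simp
    then have "(1 + 2 * M) * (2 * (M div 2)) \<le> (1 + 2 * M) * M" by (rule mult_left_mono) simp
    then show ?thesis by (simp add: algebra_simps)
  qed
  moreover have "M div 2 = (e + 1) * (card S + 1)"
    unfolding M_def mult.assoc by (rule nonzero_mult_div_cancel_left) simp
  ultimately show False by simp
qed

lemma (in embedded_field) common_denominator:
  assumes "finite S"
    and gen: "\<And>f. \<exists>c. (\<forall>s\<in>S. c s \<in> simple_ext \<iota> t) \<and> f = (\<Sum>s\<in>S. c s * s)"
    and "finite G"
  shows "\<exists>q e. q \<noteq> 0 \<and> (\<forall>g\<in>G. q * g \<in> vs.span {t ^ i * s | i s. i \<le> (e::nat) \<and> s \<in> S})"
proof -
  have "\<exists>Q P. ev t Q \<noteq> 0 \<and> ev t Q * g = (\<Sum>s\<in>S. ev t (P s) * s)" for g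
  proof -
    obtain c where c: "\<And>s. s \<in> S \<Longrightarrow> c s \<in> simple_ext \<iota> t" "g = (\<Sum>s\<in>S. c s * s)"
      using gen[of g] by blast
    have "\<forall>s\<in>S. \<exists>P Q. ev t Q \<noteq> 0 \<and> c s = ev t P / ev t Q"
      using c(1) unfolding simple_ext_def ev_def by blast
    then obtain P Q where PQ: "\<And>s. s \<in> S \<Longrightarrow> ev t (Q s) \<noteq> 0 \<and> c s = ev t (P s) / ev t (Q s)"
      by metis
    have "ev t (\<Prod>s\<in>S. Q s) * g = (\<Sum>s\<in>S. ev t (P s * (\<Prod>r\<in>S - {s}. Q r)) * s)"
      unfolding c(2) sum_distrib_left
    proof (rule sum.cong)
      fix s assume s: "s \<in> S"
      then have "ev t (\<Prod>s\<in>S. Q s) = ev t (Q s) * ev t (\<Prod>r\<in>S - {s}. Q r)"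
        by (simp add: prod.remove[OF \<open>finite S\<close>])
      then show "ev t (\<Prod>s\<in>S. Q s) * (c s * s) = ev t (P s * (\<Prod>r\<in>S - {s}. Q r)) * s"
        using PQ[OF s] by simp
    qed simp
    moreover have "ev t (\<Prod>s\<in>S. Q s) \<noteq> 0" using PQ \<open>finite S\<close> by (simp add: ev_prod)
    ultimately show ?thesis
      by (intro exI[of _ "\<Prod>s\<in>S. Q s"] exI[of _ "\<lambda>s. P s * (\<Prod>r\<in>S - {s}. Q r)"]) simp
  qed
  then obtain Q P where QP: "\<And>g. ev t (Q g) \<noteq> 0"
      "\<And>g. ev t (Q g) * g = (\<Sum>s\<in>S. ev t (P g s) * s)"
    by metis
  define P' where "P' g s = P g s * (\<Prod>r\<in>G - {g}. Q r)" for g s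
  define e where "e = Max (insert 0 ((\<lambda>(g, s). degree (P' g s)) ` (G \<times> S)))"
  have "ev t (\<Prod>g\<in>G. Q g) * g \<in> vs.span {t ^ i * s | i s. i \<le> e \<and> s \<in> S}" if "g \<in> G" for g
  proof -
    have "ev t (\<Prod>g\<in>G. Q g) * g = ev t (\<Prod>r\<in>G - {g}. Q r) * (ev t (Q g) * g)"
      by (simp add: prod.remove[OF \<open>finite G\<close> that])
    also have "\<dots> = (\<Sum>s\<in>S. ev t (P' g s) * s)"
      unfolding QP(2) by (simp add: sum_distrib_left P'_def mult_ac)
    also have "\<dots> \<in> vs.span {t ^ i * s | i s. i \<le> e \<and> s \<in> S}"
    proof (rule vs.span_sum)
      fix s assume s: "s \<in> S"
      have deg: "degree (P' g s) \<le> e"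
        unfolding e_def using \<open>finite S\<close> \<open>finite G\<close> s that by (intro Max_ge) auto
      have "ev t (P' g s) * s = (\<Sum>i\<le>degree (P' g s). \<iota> (coeff (P' g s) i) * (t ^ i * s))"
        by (subst poly_as_sum_of_monoms[symmetric])
          (simp only: ev_sum ev_monom sum_distrib_right mult.assoc)
      also have "\<dots> \<in> vs.span {t ^ i * s | i s. i \<le> e \<and> s \<in> S}"
      proof (intro vs.span_sum vs.span_scale vs.span_base)
        fix i assume "i \<in> {..degree (P' g s)}"
        then show "t ^ i * s \<in> {t ^ i * s | i s. i \<le> e \<and> s \<in> S}"
          using deg s by (auto intro!: exI[of _ i] exI[of _ s])
      qed
      finally show "ev t (P' g s) * s \<in> vs.span {t ^ i * s | i s. i \<le> e \<and> s \<in> S}" .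
    qed
    finally show ?thesis .
  qed
  moreover have "ev t (\<Prod>g\<in>G. Q g) \<noteq> 0" using QP(1) \<open>finite G\<close> by (simp add: ev_prod)
  ultimately show ?thesis by blast
qed

text \<open>Otherwise \<open>f\<close> and a uniformizer would be algebraically independent by
  \<open>transcendental_expansion\<close>, against transcendence degree one in the form of
  \<open>monomials_dependent\<close>.\<close>

lemma (in curve_place) residue_exists:
  assumes "function_field \<iota>" and f: "f \<in> R"
  shows "\<exists>c. f - \<iota> c \<in> \<mm>"
proof (rule ccontr)
  assume "\<not> ?thesis"
  then have tr: "\<And>c. f - \<iota> c \<notin> \<mm>" by blast
  obtain u where u: "u \<noteq> 0" "p u = 1" by (rule uniformizer)
  obtain t S where S: "finite S"
    and gen: "\<And>f. \<exists>c. (\<forall>s\<in>S. c s \<in> simple_ext \<iota> t) \<and> f = (\<Sum>s\<in>S. c s * s)"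
    using assms(1) unfolding function_field_def by metis
  \<comment> \<open>The finitely many elements that have to share one denominator in
    \<open>monomials_dependent\<close>.\<close>
  define G where "G = insert 1 ((\<lambda>(g, s). g * s) ` ({1, f, u} \<times> S))"
  have "finite G" using S by (simp add: G_def)
  then obtain q e where q: "q \<noteq> 0"
      "\<And>g. g \<in> G \<Longrightarrow> q * g \<in> vs.span {t ^ i * s | i s. i \<le> (e::nat) \<and> s \<in> S}"
    using common_denominator[OF S gen, of G] by blast
  have "q \<in> vs.span {t ^ i * s | i s. i \<le> e \<and> s \<in> S}"
    using q(2)[of 1] by (simp add: G_def)
  moreover have "q * (g * s) \<in> vs.span {t ^ i * s | i s. i \<le> e \<and> s \<in> S}"
    if "s \<in> S" "g \<in> {1, f, u}" for s g
    using that by (intro q(2)) (auto simp: G_def)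
  ultimately have "\<exists>M c. (\<exists>i\<le>M. \<exists>j\<le>M. c i j \<noteq> 0) \<and>
      (\<Sum>j\<le>M. \<Sum>i\<le>M. \<iota> (c i j) * f ^ i * u ^ j) = 0"
    by (rule monomials_dependent[OF S q(1)])
  then obtain M c i j where c: "(\<Sum>j\<le>M. \<Sum>i\<le>M. \<iota> (c i j) * f ^ i * u ^ j) = 0"
      and ij: "i \<le> M" "j \<le> M" "c i j \<noteq> 0"
    by (elim exE conjE)
  define P where "P j = (\<Sum>i\<le>M. monom (c i j) i)" for j
  have "(\<Sum>j<Suc M. ev f (P j) * u ^ j) = 0"
    using c by (simp only: lessThan_Suc_atMost P_def ev_sum ev_monom sum_distrib_right)
  then have "P j = 0"
    by (rule transcendental_expansion[OF f tr u]) (use ij(2) in simp)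
  moreover have "coeff (P j) i = c i j"
    using ij(1) by (simp add: P_def coeff_sum)
  ultimately show False using ij(3) by simp
qed

section \<open>Reduction of polynomials\<close>

text \<open>A relation instead of \<open>value_at\<close>: it asserts integrality together with the
  value, so the rules for sums and products carry no side conditions.\<close>

definition (in curve_place) red :: "'f \<Rightarrow> 'k \<Rightarrow> bool" where
  "red f c \<longleftrightarrow> f - \<iota> c \<in> \<mm>"

definition (in curve_place) poly_red :: "'f poly \<Rightarrow> 'k poly \<Rightarrow> bool" where
  "poly_red F P \<longleftrightarrow> (\<forall>i. red (coeff F i) (coeff P i))"

context curve_place
begin

lemma red_const [simp]: "red (\<iota> c) c"
  by (simp add: red_def)

lemma red_0 [simp]: "red 0 0" and red_1 [simp]: "red 1 1"
  using red_const[of 0] red_const[of 1] by simp_all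

lemma red_numeral [simp]: "red (numeral n) (numeral n)"
  using red_const[of "numeral n"] by simp

lemma red_add: "red f c \<Longrightarrow> red g d \<Longrightarrow> red (f + g) (c + d)"
  using m_add[of "f - \<iota> c" "g - \<iota> d"] by (simp add: red_def algebra_simps)

lemma red_minus: "red f c \<Longrightarrow> red (- f) (- c)"
  using m_minus[of "f - \<iota> c"] by (simp add: red_def algebra_simps)

lemma red_R: "red f c \<Longrightarrow> f \<in> R"
  using R_add[OF m_subset_R R_emb, of "f - \<iota> c" c] by (simp add: red_def)

lemma red_mult:
  assumes "red f c" "red g d"
  shows "red (f * g) (c * d)"
proof -
  have "g * (f - \<iota> c) + \<iota> c * (g - \<iota> d) \<in> \<mm>"
    using assms red_R[OF assms(2)] by (intro m_add m_mult) (auto simp: red_def)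
  then show ?thesis by (simp add: red_def algebra_simps)
qed

lemma red_sum: "(\<And>x. x \<in> S \<Longrightarrow> red (f x) (c x)) \<Longrightarrow> red (\<Sum>x\<in>S. f x) (\<Sum>x\<in>S. c x)"
  by (induction S rule: infinite_finite_induct) (auto intro: red_add)

lemma red_unique:
  assumes "red f c" "red f d"
  shows "c = d"
proof -
  have "red (f + - f) (c + - d)" by (intro red_add red_minus assms)
  then have "\<iota> (d - c) \<in> \<mm>" by (simp add: red_def)
  then show ?thesis unfolding emb_m_iff by simp
qed

lemma value_at_eq: "red f c \<Longrightarrow> value_at \<iota> p f = c"
  unfolding value_at_def using red_unique red_def by blast

lemma red_0_iff: "red f 0 \<longleftrightarrow> f \<in> \<mm>"
  by (simp add: red_def)

lemma poly_red_unique: "poly_red F P \<Longrightarrow> poly_red F Q \<Longrightarrow> P = Q"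
  by (auto simp: poly_red_def poly_eq_iff intro: red_unique)

lemma poly_red_0 [simp]: "poly_red 0 0"
  by (simp add: poly_red_def)

lemma poly_red_pCons: "red f c \<Longrightarrow> poly_red F P \<Longrightarrow> poly_red (pCons f F) (pCons c P)"
  by (auto simp: poly_red_def coeff_pCons split: nat.splits)

lemma poly_red_1 [simp]: "poly_red 1 1"
  unfolding one_pCons by (intro poly_red_pCons) simp_all

lemma poly_red_add: "poly_red F P \<Longrightarrow> poly_red G Q \<Longrightarrow> poly_red (F + G) (P + Q)"
  by (simp add: poly_red_def red_add)

lemma poly_red_diff: "poly_red F P \<Longrightarrow> poly_red G Q \<Longrightarrow> poly_red (F - G) (P - Q)"
  using red_add[OF _ red_minus] by (simp add: poly_red_def)

lemma poly_red_smult: "red f c \<Longrightarrow> poly_red F P \<Longrightarrow> poly_red (smult f F) (smult c P)"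
  by (simp add: poly_red_def red_mult)

lemma poly_red_mult: "poly_red F P \<Longrightarrow> poly_red G Q \<Longrightarrow> poly_red (F * G) (P * Q)"
  unfolding poly_red_def coeff_mult by (intro allI red_sum red_mult) auto

lemma poly_red_power: "poly_red F P \<Longrightarrow> poly_red (F ^ n) (P ^ n)"
  by (induction n) (auto intro: poly_red_mult)

lemmas poly_red_intros = poly_red_pCons poly_red_add poly_red_diff poly_red_smult
  poly_red_mult poly_red_power poly_red_0 poly_red_1

end

locale curve_point = curve_place +
  assumes residue: "f \<in> R \<Longrightarrow> \<exists>c. red f c"
begin

text \<open>Gauss's lemma: a factor with nonzero reduction is primitive, so it can be cancelled integrally.\<close>

lemma poly_red_cancel:
  assumes F: "poly_red F P" "P \<noteq> 0" and FG: "poly_red (F * G) S"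
  shows "\<exists>Q. poly_red G Q \<and> P * Q = S"
proof (cases "G = 0")
  case True
  then show ?thesis using FG poly_red_unique[of 0 S 0] by (auto intro!: exI[of _ 0])
next
  case False
  define I where "I = {i. coeff G i \<noteq> 0}"
  have "finite I" unfolding I_def by (rule finite_subset[of _ "{..degree G}"]) (auto intro: le_degree)
  moreover have "I \<noteq> {}" using False by (auto simp: I_def poly_eq_iff)
  ultimately obtain m where m: "m \<in> I" "\<And>i. i \<in> I \<Longrightarrow> p (coeff G m) \<le> p (coeff G i)"
    using arg_min_if_finite[of I "\<lambda>i. p (coeff G i)"] by (metis linorder_not_less)
  define w where "w = coeff G m"
  have w: "w \<noteq> 0" using m(1) by (simp add: w_def I_def)
  define H where "H = smult (inverse w) G"
  have GH: "G = smult w H" using w by (simp add: H_def)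
  have "\<exists>c. red (coeff H i) c" for i
  proof (rule residue)
    show "coeff H i \<in> R"
    proof (cases "i \<in> I")
      case True
      then have "p (coeff H i) = p (coeff G i) - p w"
        using w by (simp add: H_def I_def val_mult val_inverse)
      then show ?thesis using m(2)[OF True] by (simp add: local_ring_def w_def)
    qed (simp add: H_def I_def local_ring_def)
  qed
  then obtain c where c: "\<And>i. red (coeff H i) (c i)" by metis
  define T where "T = (\<Sum>i\<le>degree H. monom (c i) i)"
  have "coeff T i = c i" for i
  proof -
    have "c i = 0" if "i > degree H"
      using red_unique[OF c[of i]] that by (simp add: coeff_eq_0)
    then show ?thesis by (cases "i \<le> degree H") (auto simp: T_def coeff_sum)
  qed
  then have HT: "poly_red H T" using c by (simp add: poly_red_def)
  have "coeff H m = 1" using w by (simp add: H_def w_def)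
  then have "c m = 1" using c[of m] red_unique by force
  then have "T \<noteq> 0" using \<open>\<And>i. coeff T i = c i\<close> by force
  show ?thesis
  proof (cases "p w \<ge> 0")
    case True
    then obtain r where "red w r" using residue by (auto simp: local_ring_def)
    then have "poly_red G (smult r T)" unfolding GH using HT by (rule poly_red_smult)
    then show ?thesis using poly_red_unique[OF poly_red_mult[OF F(1)] FG] by blast
  next
    \<comment> \<open>If \<open>w\<close> had a pole, \<open>F * H\<close> would be
      \<open>F * G\<close> times an element of the maximal ideal and reduce to 0, although
      \<open>P\<close> and \<open>T\<close> are nonzero.\<close>
    case False
    then have "red (inverse w) 0" using w by (simp add: red_0_iff maximal_ideal_def val_inverse)
    then have "poly_red (smult (inverse w) (F * G)) (smult 0 S)" using FG by (rule poly_red_smult)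
    moreover have "smult (inverse w) (F * G) = F * H" by (simp add: H_def)
    ultimately have "P * T = 0"
      using poly_red_unique[OF poly_red_mult[OF F(1) HT]] by simp
    then show ?thesis using \<open>P \<noteq> 0\<close> \<open>T \<noteq> 0\<close> by simp
  qed
qed

end

section \<open>Multiplication by an integer in the coordinate z\<close>

text \<open>
  With \<open>z\<^sub>P\<close> denoting the coordinate of \<open>P\<close> on \<open>y\<^sup>2 = z\<^sup>3 + a2 z\<^sup>2 + a4 z + a6\<close> and
  \<open>z\<^sub>P = t / w\<close>, the coordinates of \<open>P + Q\<close> and \<open>P - Q\<close> for \<open>Q = (z, y)\<close> have sum
  \<open>sum_num / diff_sq\<close> and product \<open>prod_num / diff_sq\<close>.
\<close>

definition prod_num :: "'a::comm_ring_1 \<Rightarrow> 'a \<Rightarrow> 'a \<Rightarrow> 'a \<Rightarrow> 'a \<Rightarrow> 'a \<Rightarrow> 'a" where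
  "prod_num a2 a4 a6 z t w = (t * z - a4 * w) ^ 2 - 4 * a6 * w * (t + z * w + a2 * w)"

definition sum_num :: "'a::comm_ring_1 \<Rightarrow> 'a \<Rightarrow> 'a \<Rightarrow> 'a \<Rightarrow> 'a \<Rightarrow> 'a \<Rightarrow> 'a" where
  "sum_num a2 a4 a6 z t w =
     2 * (t * z * (t + z * w) + 2 * a2 * t * z * w + a4 * w * (t + z * w) + 2 * a6 * w ^ 2)"

definition diff_sq :: "'a::comm_ring_1 \<Rightarrow> 'a \<Rightarrow> 'a \<Rightarrow> 'a" where
  "diff_sq z t w = (t - z * w) ^ 2"

text \<open>The left side vanishes when \<open>r / s\<close> is the coordinate of
  \<open>P + Q\<close> or \<open>P - Q\<close>, where \<open>P\<close> has coordinate
  \<open>t / w\<close>. This relation between the two points is symmetric because the sign of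
  \<open>Q\<close> is left open.\<close>

lemma addition_relation_sym:
  fixes z :: "'a::comm_ring_1"
  shows "diff_sq z t w * r ^ 2 - sum_num a2 a4 a6 z t w * r * s + prod_num a2 a4 a6 z t w * s ^ 2
       = diff_sq z r s * t ^ 2 - sum_num a2 a4 a6 z r s * t * w + prod_num a2 a4 a6 z r s * w ^ 2"
  unfolding prod_num_def sum_num_def diff_sq_def by (simp add: algebra_simps power2_eq_square)

text \<open>
  One step of the recursion from \<open>(m - 1) Q\<close> and \<open>m Q\<close>, given by \<open>r / s\<close> and \<open>t / w\<close>, to
  \<open>(m + 1) Q\<close>, given by \<open>u / v\<close>.
\<close>

lemma addition_step:
  fixes z :: "'a::idom"
  assumes rel: "diff_sq z t w * r ^ 2 - sum_num a2 a4 a6 z t w * r * s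
      + prod_num a2 a4 a6 z t w * s ^ 2 = 0"
    and cop: "\<exists>x y. x * r + y * s = 1" and nz: "r \<noteq> 0" "s \<noteq> 0"
  shows "\<exists>u v. u * r = prod_num a2 a4 a6 z t w \<and> v * s = diff_sq z t w \<and>
    u * s + r * v = sum_num a2 a4 a6 z t w"
proof -
  let ?U = "prod_num a2 a4 a6 z t w" and ?V = "sum_num a2 a4 a6 z t w" and ?W = "diff_sq z t w"
  obtain x y where xy: "x * r + y * s = 1" using cop by blast
  have "?U * s ^ 2 = r * (?V * s - ?W * r)" "?W * r ^ 2 = s * (?V * r - ?U * s)"
    using rel by (simp_all add: algebra_simps power2_eq_square)
  then have div: "r dvd ?U * s ^ 2" "s dvd ?W * r ^ 2" by (metis dvd_triv_left)+
  \<comment> \<open>Divisibility is known only after multiplication by \<open>s ^ 2\<close> or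
    \<open>r ^ 2\<close>, so the Bezout identity is squared to produce these factors.\<close>
  have "?U = ?U * (x * r + y * s) ^ 2" "?W = ?W * (x * r + y * s) ^ 2" using xy by simp_all
  then have "?U = r * (?U * x * (x * r + 2 * y * s)) + y ^ 2 * (?U * s ^ 2)"
    "?W = s * (?W * y * (y * s + 2 * x * r)) + x ^ 2 * (?W * r ^ 2)"
    by (simp_all add: algebra_simps power2_eq_square)
  then have "r dvd ?U" "s dvd ?W" using div by (metis dvd_add dvd_mult dvd_triv_left)+
  then obtain u v where uv: "?U = r * u" "?W = s * v" by (elim dvdE)
  have "(r * s) * ?V = (r * s) * (u * s + r * v)" using rel unfolding uv
    by (simp add: algebra_simps power2_eq_square)
  then have "?V = u * s + r * v" using nz by simp
  then show ?thesis using uv by (metis mult.commute)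
qed

text \<open>
  If \<open>u\<close> and \<open>v\<close> had a common zero, then \<open>t = z w\<close> there, and \<open>U = V = 0\<close> would be the numerator
  and denominator of the duplication formula up to \<open>w\<^sup>2\<close>; these are coprime as the
  discriminant \<open>D\<close> is a unit.
\<close>

lemma addition_coprime:
  fixes z :: "'a::comm_ring_1"
  assumes rec: "u * r = prod_num a2 a4 a6 z t w" "v * s = diff_sq z t w"
      "u * s + r * v = sum_num a2 a4 a6 z t w"
    and cop: "\<exists>x y. x * t + y * w = 1"
    and disc: "\<exists>\<alpha> \<beta>. \<alpha> * prod_num a2 a4 a6 z z 1 + \<beta> * sum_num a2 a4 a6 z z 1 = 1"
  shows "\<exists>x y. x * u + y * v = 1"
proof -
  obtain x y where xy: "x * t + y * w = 1" using cop by blast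
  obtain \<alpha> \<beta> where ab: "\<alpha> * prod_num a2 a4 a6 z z 1 + \<beta> * sum_num a2 a4 a6 z z 1 = 1"
    using disc by blast
  define e where "e = t - z * w"
  have t: "t = z * w + e" by (simp add: e_def)
  have 1: "e ^ 2 = v * s" using rec(2) by (simp add: diff_sq_def e_def)
  \<comment> \<open>Modulo \<open>e\<close> one has \<open>t = z * w\<close>, and
    \<open>prod_num\<close> and \<open>sum_num\<close> become \<open>w ^ 2\<close> times the
    duplication polynomials, whose combination is 1.\<close>
  obtain g where g: "\<alpha> * (u * r) + \<beta> * (u * s + r * v) = w ^ 2 + e * g"
  proof
    let ?g = "\<alpha> * (2 * z * (z ^ 2 - a4) * w + z ^ 2 * e - 4 * a6 * w)
      + \<beta> * 2 * (z * (3 * z * w + e) + 2 * a2 * z * w + a4 * w)"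
    have "\<alpha> * (u * r) + \<beta> * (u * s + r * v) = (\<alpha> * prod_num a2 a4 a6 z z 1
        + \<beta> * sum_num a2 a4 a6 z z 1) * w ^ 2 + e * ?g"
      unfolding rec unfolding t prod_num_def sum_num_def
      by (simp add: algebra_simps power2_eq_square)
    then show "\<alpha> * (u * r) + \<beta> * (u * s + r * v) = w ^ 2 + e * ?g" using ab by simp
  qed
  define h where "h = \<alpha> * (u * r) + \<beta> * (u * s + r * v)"
  have h: "h = w ^ 2 + e * g" using g by (simp add: h_def)
  \<comment> \<open>Both \<open>h\<close> and \<open>e ^ 2\<close> lie in the ideal generated by
    \<open>u\<close> and \<open>v\<close>, hence so does \<open>w ^ 4\<close>.\<close>
  have w4: "w ^ 4 = h * (w ^ 2 - e * g) + g ^ 2 * e ^ 2"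
    unfolding h by (simp add: algebra_simps power2_eq_square power4_eq_xxxx)
  define b where "b = x * e"
  define k where "k = x * z + y"
  define c where "c = 1 + 4 * b"
  define d where "d = x ^ 2 * (10 - 20 * b + 15 * b ^ 2 - 4 * b ^ 3)"
  have kw: "k * w = 1 - b" using xy unfolding k_def t b_def by (simp add: algebra_simps)
  \<comment> \<open>\<open>1 + 4 * b\<close> inverts \<open>(1 - b) ^ 4\<close> modulo
    \<open>b ^ 2\<close>, and the second summand is the remainder. As \<open>b ^ 2\<close> is a
    multiple of \<open>e ^ 2\<close> and \<open>1 - b\<close> one of \<open>w\<close>, both summands
    lie in the ideal of \<open>u\<close> and \<open>v\<close>.\<close>
  have "1 = (1 - b) ^ 4 * (1 + 4 * b) + b ^ 2 * (10 - 20 * b + 15 * b ^ 2 - 4 * b ^ 3)"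
    by (simp add: algebra_simps eval_nat_numeral)
  also have "\<dots> = k ^ 4 * w ^ 4 * c + e ^ 2 * d"
    unfolding kw[symmetric] power_mult_distrib c_def d_def by (simp add: b_def power_mult_distrib)
  also have "\<dots> = k ^ 4 * (h * (w ^ 2 - e * g) + g ^ 2 * (v * s)) * c + v * s * d"
    unfolding w4 1 ..
  also have "\<dots> = (k ^ 4 * (w ^ 2 - e * g) * c * (\<alpha> * r + \<beta> * s)) * u
      + (k ^ 4 * (w ^ 2 - e * g) * c * \<beta> * r + (k ^ 4 * g ^ 2 * c + d) * s) * v"
    unfolding h_def by (simp add: algebra_simps)
  finally show ?thesis by metis
qed

text \<open>
  Numerator and denominator of \<open>z \<circ> [m]\<close>.  The recursion divides exactly; its third equation
  needs two previous values with nonzero denominator, so the duplication formula is a start value.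
\<close>

fun mult_map :: "'a::field \<Rightarrow> 'a \<Rightarrow> 'a \<Rightarrow> nat \<Rightarrow> 'a poly \<times> 'a poly" where
  "mult_map a2 a4 a6 0 = (1, 0)"
| "mult_map a2 a4 a6 (Suc 0) = ([:0, 1:], 1)"
| "mult_map a2 a4 a6 (Suc (Suc 0)) =
     (prod_num [:a2:] [:a4:] [:a6:] [:0, 1:] [:0, 1:] 1,
      sum_num [:a2:] [:a4:] [:a6:] [:0, 1:] [:0, 1:] 1)"
| "mult_map a2 a4 a6 (Suc (Suc (Suc m))) =
     (let (r, s) = mult_map a2 a4 a6 (Suc m); (t, w) = mult_map a2 a4 a6 (Suc (Suc m))
      in (prod_num [:a2:] [:a4:] [:a6:] [:0, 1:] t w div r, diff_sq [:0, 1:] t w div s))"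

section \<open>The recursion and its reduction at the node\<close>

locale nodal_reduction = curve_point \<iota> p
  for \<iota> :: "'k::{alg_closed_field, field_char_0} \<Rightarrow> 'f::field" and p +
  fixes a2 a4 a6 :: 'f and \<mu> :: 'k
  assumes red_a2: "red a2 \<mu>" and red_a4: "red a4 0" and red_a6: "red a6 0" and node: "\<mu> \<noteq> 0"
    and nonsingular: "\<exists>\<alpha> \<beta>. \<alpha> * prod_num [:a2:] [:a4:] [:a6:] [:0, 1:] [:0, 1:] 1
      + \<beta> * sum_num [:a2:] [:a4:] [:a6:] [:0, 1:] [:0, 1:] 1 = 1"
begin

abbreviation "prodp \<equiv> prod_num [:a2:] [:a4:] [:a6:] [:0, 1:]"
abbreviation "sump \<equiv> sum_num [:a2:] [:a4:] [:a6:] [:0, 1:]"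
abbreviation "diffp \<equiv> diff_sq [:0, 1::'f:]"

definition num where "num m = fst (mult_map a2 a4 a6 m)"
definition den where "den m = snd (mult_map a2 a4 a6 m)"

text \<open>Coprimeness makes the next division exact, and nonzero reductions make both entries
  primitive, so that the quotients can be computed after reduction by
  \<open>poly_red_cancel\<close>.\<close>

definition good :: "nat \<Rightarrow> 'f poly \<Rightarrow> 'f poly \<Rightarrow> bool" where
  "good m t w \<longleftrightarrow> (\<exists>x y. x * t + y * w = 1) \<and> poly_red t ([:0, 1:] ^ m\<^sup>2) \<and>
     (\<exists>W. poly_red w W \<and> W \<noteq> 0 \<and> order 0 W = m * (m - 1))"

lemma poly_red_X: "poly_red [:0, 1:] [:0, 1:]"
  by (intro poly_red_intros) auto

lemma poly_red_const: "red c d \<Longrightarrow> poly_red [:c:] [:d:]"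
  by (intro poly_red_intros)

lemma poly_red_numeral [simp]: "poly_red (numeral n) (numeral n)"
  unfolding numeral_poly by (intro poly_red_const) simp

text \<open>With \<open>a4\<close> and \<open>a6\<close> reducing to 0, \<open>prod_num\<close>
  collapses to a square, which is why the numerators reduce to pure powers of z.\<close>

lemma poly_red_num_den:
  assumes "poly_red t T" "poly_red w W"
  shows "poly_red (prodp t w) (([:0, 1:] * T) ^ 2)"
    and "poly_red (diffp t w) ((T - [:0, 1:] * W) ^ 2)"
    and "poly_red (sump t w) (sum_num [:\<mu>:] 0 0 [:0, 1:] T W)"
proof -
  have "poly_red (prodp t w) (prod_num [:\<mu>:] [:0:] [:0:] [:0, 1:] T W)"
    unfolding prod_num_def
    by (intro poly_red_diff poly_red_add poly_red_mult poly_red_power poly_red_const poly_red_X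
        assms red_a2 red_a4 red_a6 poly_red_numeral)
  then show "poly_red (prodp t w) (([:0, 1:] * T) ^ 2)"
    by (simp add: prod_num_def mult.commute)
  show "poly_red (diffp t w) ((T - [:0, 1:] * W) ^ 2)"
    unfolding diff_sq_def
    by (intro poly_red_diff poly_red_mult poly_red_power poly_red_X assms)
  have "poly_red (sump t w) (sum_num [:\<mu>:] [:0:] [:0:] [:0, 1:] T W)"
    unfolding sum_num_def
    by (intro poly_red_add poly_red_mult poly_red_power poly_red_const poly_red_X
        assms red_a2 red_a4 red_a6 poly_red_numeral)
  then show "poly_red (sump t w) (sum_num [:\<mu>:] 0 0 [:0, 1:] T W)" by simp
qed

lemma order_0_X_power: "order 0 ([:0, 1:] ^ k :: 'k poly) = k"
  using order_power_n_n[of "0::'k" k] by simp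

lemma order_0_X_power_mult:
  assumes "poly q 0 \<noteq> (0::'k)"
  shows "order 0 ([:0, 1:] ^ k * q) = k"
proof -
  have "order 0 q = 0" using assms by (rule order_0I)
  moreover have "[:0, 1:] ^ k * q \<noteq> 0" using assms by auto
  ultimately show ?thesis by (simp add: order_mult order_0_X_power)
qed

lemma good_not_0:
  assumes "good m t w"
  shows "t \<noteq> 0" "w \<noteq> 0"
  using assms poly_red_unique[OF poly_red_0] unfolding good_def by (metis power_not_zero pCons_eq_0_iff one_neq_zero)+

lemma good_step:
  assumes r: "good m r s" and t: "good (Suc m) t w" and m: "m \<ge> 1"
    and uv: "u * r = prodp t w" "v * s = diffp t w" "u * s + r * v = sump t w"
  shows "good (Suc (Suc m)) u v"
proof -
  let ?X = "[:0, 1::'k:]"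
  obtain S W where S: "poly_red s S" "S \<noteq> 0" "order 0 S = m * (m - 1)"
    and W: "poly_red w W" "W \<noteq> 0" "order 0 W = Suc m * m"
    using r t by (auto simp: good_def)
  have r': "poly_red r (?X ^ m\<^sup>2)" and t': "poly_red t (?X ^ (Suc m)\<^sup>2)"
    using r t by (auto simp: good_def)
  have cop: "\<exists>x y. x * u + y * v = 1"
    using t by (intro addition_coprime[OF uv _ nonsingular]) (simp add: good_def)
  have "poly_red (r * u) ((?X * ?X ^ (Suc m)\<^sup>2) ^ 2)"
    using poly_red_num_den(1)[OF t' W(1)] uv(1) by (simp add: mult.commute)
  then obtain Q where Q: "poly_red u Q" "?X ^ m\<^sup>2 * Q = (?X * ?X ^ (Suc m)\<^sup>2) ^ 2"
    using poly_red_cancel[OF r'] by auto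
  \<comment> \<open>\<open>2 (1 + (m + 1)^2) = m^2 + (m + 2)^2\<close>, so dividing by the numerator
    at \<open>m\<close> leaves the next square exponent.\<close>
  have "(?X * ?X ^ (Suc m)\<^sup>2) ^ 2 = ?X ^ (m\<^sup>2 + (Suc (Suc m))\<^sup>2)"
    unfolding power_Suc[symmetric] power_mult[symmetric]
    by (rule arg_cong[of _ _ "power ?X"]) (simp add: power2_eq_square algebra_simps)
  then have "Q = ?X ^ (Suc (Suc m))\<^sup>2" using Q(2) by (simp add: power_add)
  moreover have "\<exists>V. poly_red v V \<and> V \<noteq> 0 \<and> order 0 V = Suc (Suc m) * Suc m"
  proof -
    obtain h where h: "W = ?X ^ (Suc m * m) * h" "poly h 0 \<noteq> 0"
      using order_decomp[OF W(2), of 0] W(3) by (auto simp: poly_eq_0_iff_dvd)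
    \<comment> \<open>The order of \<open>?X * W\<close> at 0. The other term has order
      \<open>k + m\<close>, strictly larger as \<open>m \<ge> 1\<close>, so the difference has order
      exactly \<open>k\<close>. Finally \<open>2 k = m (m - 1) + (m + 2) (m + 1)\<close>.\<close>
    define k where "k = Suc (Suc m * m)"
    have sq: "(Suc m)\<^sup>2 = k + m" by (simp add: k_def power2_eq_square)
    have D: "(?X ^ (Suc m)\<^sup>2 - ?X * W) ^ 2 = ?X ^ (k + k) * (?X ^ m - h) ^ 2"
      unfolding h(1) sq by (simp add: k_def power_add power2_eq_square algebra_simps)
    have "poly_red (s * v) ((?X ^ (Suc m)\<^sup>2 - ?X * W) ^ 2)"
      using poly_red_num_den(2)[OF t' W(1)] uv(2) by (simp add: mult.commute)
    then obtain V where V: "poly_red v V" "S * V = ?X ^ (k + k) * (?X ^ m - h) ^ 2"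
      using poly_red_cancel[OF S(1,2)] D by auto
    have h': "poly ((?X ^ m - h) ^ 2) 0 \<noteq> 0" using h(2) m by (simp add: power_0_left)
    then have "S * V \<noteq> 0" unfolding V(2) by auto
    moreover have "order 0 (S * V) = k + k"
      unfolding V(2) using h' by (rule order_0_X_power_mult)
    ultimately have "V \<noteq> 0" "m * (m - 1) + order 0 V = k + k"
      using S(3) by (auto simp: order_mult)
    moreover have "k + k = m * (m - 1) + Suc (Suc m) * Suc m"
      using m by (cases m) (simp_all add: k_def)
    ultimately show ?thesis using V(1) by auto
  qed
  ultimately show ?thesis using Q(1) cop by (auto simp: good_def)
qed

lemma good_1: "good 1 [:0, 1:] 1"
  unfolding good_def
proof (intro conjI)
  show "\<exists>x y. x * [:0, 1:] + y * 1 = (1::'f poly)"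
    by (intro exI[of _ 0] exI[of _ 1]) simp
  show "\<exists>W. poly_red 1 W \<and> W \<noteq> 0 \<and> order 0 W = 1 * (1 - 1)"
    by (intro exI[of _ 1]) (simp add: order_0I)
qed (use poly_red_X in simp)

lemma good_2: "good 2 (prodp [:0, 1:] 1) (sump [:0, 1:] 1)"
  unfolding good_def
proof (intro conjI)
  show "\<exists>x y. x * prodp [:0, 1:] 1 + y * sump [:0, 1:] 1 = 1"
    by (rule nonsingular)
  show "poly_red (prodp [:0, 1:] 1) ([:0, 1:] ^ 2\<^sup>2)"
    using poly_red_num_den(1)[OF poly_red_X poly_red_1]
    by (simp add: power2_eq_square eval_nat_numeral)
  let ?W = "[:0, 1:] ^ 2 * [:4 * \<mu>, 4:]"
  have "sum_num [:\<mu>:] 0 0 [:0, 1:] [:0, 1:] 1 = ?W"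
    by (simp add: sum_num_def power2_eq_square numeral_poly)
  then have "poly_red (sump [:0, 1:] 1) ?W"
    using poly_red_num_den(3)[OF poly_red_X poly_red_1] by simp
  moreover have "?W \<noteq> 0" unfolding mult_eq_0_iff by simp
  moreover have "order 0 ?W = 2" using node by (intro order_0_X_power_mult) simp
  ultimately show "\<exists>W. poly_red (sump [:0, 1:] 1) W \<and> W \<noteq> 0 \<and> order 0 W = 2 * (2 - 1)"
    by (intro exI[of _ ?W]) simp
qed

text \<open>\<open>mult_map\<close> uses polynomial division with remainder. The exact quotients
  from \<open>addition_step\<close> show that no remainder occurs.\<close>

lemma num_den_recursion:
  assumes m: "m \<ge> 1" and g: "good m (num m) (den m)"
    and rel: "diffp (num (Suc m)) (den (Suc m)) * num m ^ 2
      - sump (num (Suc m)) (den (Suc m)) * num m * den m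
      + prodp (num (Suc m)) (den (Suc m)) * den m ^ 2 = 0"
  shows "num (Suc (Suc m)) * num m = prodp (num (Suc m)) (den (Suc m))"
    and "den (Suc (Suc m)) * den m = diffp (num (Suc m)) (den (Suc m))"
    and "num (Suc (Suc m)) * den m + num m * den (Suc (Suc m)) = sump (num (Suc m)) (den (Suc m))"
proof -
  let ?t = "num (Suc m)" and ?w = "den (Suc m)"
  have "\<exists>u v. u * num m = prodp ?t ?w \<and> v * den m = diffp ?t ?w \<and> u * den m + num m * v = sump ?t ?w"
    using rel g good_not_0[OF g] by (intro addition_step) (auto simp: good_def)
  then obtain u v where uv: "u * num m = prodp ?t ?w" "v * den m = diffp ?t ?w"
      "u * den m + num m * v = sump ?t ?w"
    by blast
  obtain l where l: "m = Suc l" using m by (cases m) auto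
  have "num (Suc (Suc m)) = prodp ?t ?w div num m" "den (Suc (Suc m)) = diffp ?t ?w div den m"
    by (simp_all add: l num_def den_def Let_def case_prod_unfold)
  then have "num (Suc (Suc m)) = u" "den (Suc (Suc m)) = v"
    using good_not_0[OF g] by (simp_all flip: uv(1,2))
  then show "num (Suc (Suc m)) * num m = prodp ?t ?w" "den (Suc (Suc m)) * den m = diffp ?t ?w"
    "num (Suc (Suc m)) * den m + num m * den (Suc (Suc m)) = sump ?t ?w"
    using uv by simp_all
qed

lemma num_den_invariant:
  assumes "m \<ge> 1"
  shows "good m (num m) (den m) \<and> good (Suc m) (num (Suc m)) (den (Suc m)) \<and>
    diffp (num (Suc m)) (den (Suc m)) * num m ^ 2
      - sump (num (Suc m)) (den (Suc m)) * num m * den m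
      + prodp (num (Suc m)) (den (Suc m)) * den m ^ 2 = 0"
  using assms
proof (induction m rule: nat_induct_at_least)
  case base
  \<comment> \<open>After exchanging the two points, \<open>diff_sq\<close> at \<open>(z, 1)\<close>
    is 0 and the other two coefficients are \<open>w\<close> and \<open>t\<close> themselves, so the
    terms cancel.\<close>
  have "diffp t w * [:0, 1:] ^ 2 - sump t w * [:0, 1:] * 1 + prodp t w * 1 ^ 2 = 0"
    if "t = prodp [:0, 1:] 1" "w = sump [:0, 1:] 1" for t w
    by (subst addition_relation_sym)
      (simp add: that[symmetric] diff_sq_def power2_eq_square)
  then show ?case
    using good_1 good_2 by (simp add: num_def den_def numeral_2_eq_2)
next
  case (Suc m)
  let ?t = "num (Suc m)" and ?w = "den (Suc m)"
  let ?u = "num (Suc (Suc m))" and ?v = "den (Suc (Suc m))"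
  have g: "good m (num m) (den m)" "good (Suc m) ?t ?w" using Suc by auto
  note uv = num_den_recursion[OF Suc.hyps g(1) Suc.IH[THEN conjunct2, THEN conjunct2]]
  \<comment> \<open>Read the other way round, this is the quadratic whose roots are the coordinates
    at \<open>m\<close> and \<open>m + 2\<close>, evaluated at the latter.\<close>
  have "diffp ?u ?v * ?t ^ 2 - sump ?u ?v * ?t * ?w + prodp ?u ?v * ?w ^ 2
      = diffp ?t ?w * ?u ^ 2 - sump ?t ?w * ?u * ?v + prodp ?t ?w * ?v ^ 2"
    by (rule addition_relation_sym)
  also have "\<dots> = 0"
    unfolding uv[symmetric] by (simp add: algebra_simps power2_eq_square)
  finally show ?case
    using g(2) good_step[OF g Suc.hyps uv] by blast
qed

lemmas num_den_good = num_den_invariant[THEN conjunct1]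

lemma den_Suc_Suc: "m \<ge> 1 \<Longrightarrow> den (Suc (Suc m)) * den m = diffp (num (Suc m)) (den (Suc m))"
  and num_Suc_Suc: "m \<ge> 1 \<Longrightarrow> num (Suc (Suc m)) * den m + num m * den (Suc (Suc m)) =
    sump (num (Suc m)) (den (Suc m))"
  using num_den_invariant num_den_recursion by blast+

end

section \<open>The group law\<close>

text \<open>
  The line of slope \<open>s\<close> through \<open>(x, y)\<close> meets the curve again over \<open>x + d\<close>, possibly with
  \<open>d = 0\<close>; the third hypothesis is the curve equation at that point divided by \<open>d\<close>.
\<close>

lemma third_intersection:
  fixes x :: "'a::field"
  assumes y: "y ^ 2 = x ^ 3 + A * x + B"
    and s: "2 * y * s + s ^ 2 * d = 3 * x ^ 2 + 3 * x * d + d ^ 2 + A"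
    and xm: "xm = s ^ 2 - 2 * x - d"
  shows "(s * (x - xm) - y) ^ 2 = xm ^ 3 + A * xm + B"
proof -
  define e where "e = xm - x"
  have xe: "xm = x + e" by (simp add: e_def)
  \<comment> \<open>Vieta for the three intersections over \<open>x\<close>, \<open>x + d\<close>
    and \<open>x + e\<close>. It allows \<open>d\<close> to be exchanged for \<open>e\<close> in the
    hypothesis on the slope.\<close>
  have "s ^ 2 = e + d + 3 * x" using xm unfolding e_def by (simp add: algebra_simps)
  then have "s ^ 2 * (e - d) = 3 * x * (e - d) + e ^ 2 - d ^ 2"
    by (simp add: algebra_simps power2_eq_square)
  then have "(2 * y * s + s ^ 2 * d) + s ^ 2 * (e - d)
      = (3 * x ^ 2 + 3 * x * d + d ^ 2 + A) + (3 * x * (e - d) + e ^ 2 - d ^ 2)"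
    unfolding s by simp
  then have "2 * y * s + s ^ 2 * e = 3 * x ^ 2 + 3 * x * e + e ^ 2 + A"
    by (simp add: algebra_simps)
  then have "e * (2 * y * s + s ^ 2 * e) = e * (3 * x ^ 2 + 3 * x * e + e ^ 2 + A)" by simp
  then show ?thesis
    using y unfolding xe by (simp add: algebra_simps power2_eq_square power3_eq_cube)
qed

text \<open>The last equation is the chord relation backwards: the chord from
  \<open>(xm', ym')\<close> to \<open>(x, - y)\<close> leads back to the abscissa
  \<open>xm\<close>.\<close>

lemma ec_add_chord:
  fixes x :: "'a::field"
  assumes y: "y ^ 2 = x ^ 3 + A * x + B" and ym: "ym ^ 2 = xm ^ 3 + A * xm + B" and ne: "xm \<noteq> x"
  obtains xm' ym' where "ec_add A (Affine x y) (Affine xm ym) = Affine xm' ym'"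
    "ym' ^ 2 = xm' ^ 3 + A * xm' + B"
    "(xm' + x + xm) * (xm - x) ^ 2 = (ym - y) ^ 2"
    "(xm' + x + xm) * (xm' - x) ^ 2 = (ym' + y) ^ 2"
proof
  define s where "s = (ym - y) / (xm - x)"
  define xm' where "xm' = s ^ 2 - x - xm"
  define ym' where "ym' = s * (x - xm') - y"
  have s: "s * (xm - x) = ym - y" using ne by (simp add: s_def)
  show "ec_add A (Affine x y) (Affine xm ym) = Affine xm' ym'"
    using ne by (simp add: xm'_def ym'_def s_def Let_def)
  have xx: "xm' + x + xm = s ^ 2" by (simp add: xm'_def)
  show "(xm' + x + xm) * (xm - x) ^ 2 = (ym - y) ^ 2"
    unfolding xx s[symmetric] by (simp add: power_mult_distrib)
  show "(xm' + x + xm) * (xm' - x) ^ 2 = (ym' + y) ^ 2"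
    unfolding xx ym'_def by (simp add: power_mult_distrib power2_commute[of xm' x])
  define d where "d = xm - x"
  have xd: "xm = x + d" and yd: "ym = y + s * d" using s by (simp_all add: d_def)
  have "d * (2 * y * s + s ^ 2 * d) = d * (3 * x ^ 2 + 3 * x * d + d ^ 2 + A)"
    using y ym unfolding xd yd by (simp add: algebra_simps power2_eq_square power3_eq_cube)
  then have "2 * y * s + s ^ 2 * d = 3 * x ^ 2 + 3 * x * d + d ^ 2 + A"
    using ne by (simp add: d_def)
  then show "ym' ^ 2 = xm' ^ 3 + A * xm' + B"
    unfolding ym'_def by (rule third_intersection[OF y]) (simp_all add: xm'_def xd)
qed

lemma ec_add_tangent:
  fixes x :: "'a::field"
  assumes y: "y ^ 2 = x ^ 3 + A * x + B" and ne: "2 * y \<noteq> 0"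
  obtains xm' ym' where "ec_add A (Affine x y) (Affine x y) = Affine xm' ym'"
    "ym' ^ 2 = xm' ^ 3 + A * xm' + B"
    "(xm' + 2 * x) * (2 * y) ^ 2 = (3 * x ^ 2 + A) ^ 2"
    "(xm' + 2 * x) * (xm' - x) ^ 2 = (ym' + y) ^ 2"
proof
  define s where "s = (3 * x ^ 2 + A) / (2 * y)"
  define xm' where "xm' = s ^ 2 - x - x"
  define ym' where "ym' = s * (x - xm') - y"
  have s: "s * (2 * y) = 3 * x ^ 2 + A" using ne by (simp add: s_def)
  have "y \<noteq> - y" using ne by (metis mult_2 add.left_inverse)
  then show "ec_add A (Affine x y) (Affine x y) = Affine xm' ym'"
    by (simp add: xm'_def ym'_def s_def Let_def)
  have xx: "xm' + 2 * x = s ^ 2" by (simp add: xm'_def)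
  show "(xm' + 2 * x) * (2 * y) ^ 2 = (3 * x ^ 2 + A) ^ 2"
    unfolding xx s[symmetric] by (simp add: power_mult_distrib)
  show "(xm' + 2 * x) * (xm' - x) ^ 2 = (ym' + y) ^ 2"
    unfolding xx ym'_def by (simp add: power_mult_distrib power2_commute[of xm' x])
  show "ym' ^ 2 = xm' ^ 3 + A * xm' + B"
    unfolding ym'_def
    by (intro third_intersection[OF y, of s 0]) (use s in \<open>simp_all add: xm'_def mult_ac\<close>)
qed

text \<open>That \<open>m Q\<close> is \<open>(m + 1) Q - Q\<close> would follow from associativity;
  the induction instead carries the backward chord relation, which records it for abscissas. Nonzero
  \<open>D m\<close> keep all multiples up to \<open>n\<close> affine.\<close>

lemma ec_mult_coordinate:
  fixes x :: "'a::field" and N D :: "nat \<Rightarrow> 'a"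
  assumes y: "y ^ 2 = x ^ 3 + A * x + B"
    and a: "a2 = 3 * lam" "a4 = 3 * lam ^ 2 + A" "a6 = lam ^ 3 + A * lam + B"
    and x: "x = z + lam"
    and ND1: "N 1 = z" "D 1 = 1"
    and ND2: "N 2 = prod_num a2 a4 a6 z z 1" "D 2 = sum_num a2 a4 a6 z z 1"
    and D: "\<And>m. m \<ge> 1 \<Longrightarrow> D (Suc (Suc m)) * D m = diff_sq z (N (Suc m)) (D (Suc m))"
    and N: "\<And>m. m \<ge> 1 \<Longrightarrow> N (Suc (Suc m)) * D m + N m * D (Suc (Suc m)) =
      sum_num a2 a4 a6 z (N (Suc m)) (D (Suc m))"
    and nz: "\<And>m. 1 \<le> m \<Longrightarrow> m \<le> n \<Longrightarrow> D m \<noteq> 0"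
    and n: "n \<ge> 2"
  shows "\<exists>xm ym. ec_mult A n (Affine x y) = Affine xm ym \<and> (xm - lam) * D n = N n"
proof -
  let ?Q = "Affine x y"
  have mult_Suc: "ec_mult A (Suc m) ?Q = ec_add A ?Q (ec_mult A m ?Q)" for m
    by (simp add: ec_mult_def)
  have "\<exists>xm ym xm' ym'. ec_mult A m ?Q = Affine xm ym \<and> ec_mult A (Suc m) ?Q = Affine xm' ym' \<and>
      ym' ^ 2 = xm' ^ 3 + A * xm' + B \<and> (xm' + x + xm) * (xm' - x) ^ 2 = (ym' + y) ^ 2 \<and>
      (xm - lam) * D m = N m \<and> (xm' - lam) * D (Suc m) = N (Suc m)"
    if "m \<ge> 1" "Suc m \<le> n" for m
    using that
  proof (induction m rule: nat_induct_at_least)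
    case base
    have "D 2 = (2 * y) ^ 2"
      unfolding ND2 sum_num_def a power_mult_distrib y x
      by (simp add: algebra_simps power2_eq_square power3_eq_cube)
    then have "2 * y \<noteq> 0" using nz[of 2] n by (metis one_le_numeral power_zero_numeral)
    from ec_add_tangent[OF y this] obtain xm' ym' where xm': "ec_add A ?Q ?Q = Affine xm' ym'"
      "ym' ^ 2 = xm' ^ 3 + A * xm' + B"
      "(xm' + 2 * x) * (2 * y) ^ 2 = (3 * x ^ 2 + A) ^ 2"
      "(xm' + 2 * x) * (xm' - x) ^ 2 = (ym' + y) ^ 2" .
    have "(xm' - lam) * D 2 = (3 * x ^ 2 + A) ^ 2 - (2 * x + lam) * (2 * y) ^ 2"
      using xm'(3) \<open>D 2 = (2 * y) ^ 2\<close> by (simp add: algebra_simps)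
    also have "\<dots> = N 2"
      unfolding ND2 prod_num_def a power_mult_distrib y x
      by (simp add: algebra_simps power2_eq_square power3_eq_cube)
    finally show ?case
      using xm' ND1 x mult_Suc[of 0] mult_Suc[of 1]
      by (simp add: numeral_2_eq_2 ec_mult_def add.assoc)
  next
    case (Suc m)
    then obtain xm ym xm' ym' where xm: "ec_mult A m ?Q = Affine xm ym" "(xm - lam) * D m = N m"
      and xm': "ec_mult A (Suc m) ?Q = Affine xm' ym'" "ym' ^ 2 = xm' ^ 3 + A * xm' + B"
        "(xm' + x + xm) * (xm' - x) ^ 2 = (ym' + y) ^ 2" "(xm' - lam) * D (Suc m) = N (Suc m)"
      by auto
    have nz': "D m \<noteq> 0" "D (Suc m) \<noteq> 0" "D (Suc (Suc m)) \<noteq> 0"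
      by (rule nz; use Suc.prems Suc.hyps in simp)+
    have DD: "D (Suc (Suc m)) * D m = ((xm' - x) * D (Suc m)) ^ 2"
      unfolding D[OF Suc.hyps] diff_sq_def xm'(4)[symmetric] x by (simp add: algebra_simps)
    then have "xm' \<noteq> x" using nz' by auto
    from ec_add_chord[OF y xm'(2) this] obtain xm'' ym'' where
      xm'': "ec_add A ?Q (Affine xm' ym') = Affine xm'' ym''"
      "ym'' ^ 2 = xm'' ^ 3 + A * xm'' + B"
      "(xm'' + x + xm') * (xm' - x) ^ 2 = (ym' - y) ^ 2"
      "(xm'' + x + xm') * (xm'' - x) ^ 2 = (ym'' + y) ^ 2" .
    \<comment> \<open>Adding the chord relations for both neighbours cancels the mixed term in
      \<open>y\<close> and \<open>ym'\<close>, and the curve equation then removes the two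
      squares.\<close>
    have "((xm'' - lam) + (xm - lam)) * (xm' - x) ^ 2
      = (xm'' + x + xm') * (xm' - x) ^ 2 + (xm' + x + xm) * (xm' - x) ^ 2
        - 2 * (xm' + x + lam) * (xm' - x) ^ 2"
      by (simp add: algebra_simps)
    also have "\<dots> = 2 * ym' ^ 2 + 2 * y ^ 2 - 2 * (xm' + x + lam) * (xm' - x) ^ 2"
      unfolding xm''(3) xm'(3) by (simp add: algebra_simps power2_eq_square)
    also have "\<dots> = sum_num a2 a4 a6 z (xm' - lam) 1"
      unfolding xm'(2) y sum_num_def a x
      by (simp add: algebra_simps power2_eq_square power3_eq_cube)
    finally have sum: "((xm'' - lam) + (xm - lam)) * (xm' - x) ^ 2 * D (Suc m) ^ 2
      = sum_num a2 a4 a6 z (xm' - lam) 1 * D (Suc m) ^ 2" by simp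
    also have "\<dots> = sum_num a2 a4 a6 z (N (Suc m)) (D (Suc m))"
      unfolding xm'(4)[symmetric] sum_num_def by (simp add: algebra_simps power2_eq_square)
    also have "\<dots> = N (Suc (Suc m)) * D m + (xm - lam) * (D (Suc (Suc m)) * D m)"
      unfolding N[OF Suc.hyps, symmetric] xm(2)[symmetric] by (simp add: algebra_simps)
    finally have "(xm'' - lam) * (D (Suc (Suc m)) * D m) = N (Suc (Suc m)) * D m"
      unfolding DD power_mult_distrib by (simp add: algebra_simps)
    then have "(xm'' - lam) * D (Suc (Suc m)) = N (Suc (Suc m))" using nz'(1) by simp
    then show ?case
      using xm' xm'' mult_Suc[of "Suc m"] by (simp add: add_ac)
  qed
  note * = this
  have n': "n - 1 \<ge> 1" "Suc (n - 1) \<le> n" "Suc (n - 1) = n" using n by auto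
  from *[OF n'(1,2), unfolded n'(3)] show ?thesis by blast
qed

section \<open>Unstable pairs of forms\<close>

lemma semistable_conj_act:
  assumes "semistable d P" and "\<alpha> * \<delta> - \<beta> * \<gamma> = 1"
  shows "semistable d (conj_act d \<alpha> \<beta> \<gamma> \<delta> P)"
  using assms unfolding semistable_def by (metis (no_types, lifting))

lemma form_subst_diag:
  assumes "i \<le> d"
  shows "form_subst d \<alpha> 0 0 \<delta> a i = a i * \<alpha> ^ (d - i) * \<delta> ^ i"
proof -
  have "[:\<alpha>, 0:] ^ (d - j) * [:0, \<delta>:] ^ j = monom (\<alpha> ^ (d - j) * \<delta> ^ j) j" for j
  proof -
    have "[:\<alpha>, 0:] = [:\<alpha>:]" "[:0, \<delta>:] = monom \<delta> 1" by (simp_all add: monom_altdef)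
    then show ?thesis by (simp add: monom_power smult_monom poly_const_pow)
  qed
  then have "form_subst d \<alpha> 0 0 \<delta> a i = (\<Sum>j\<le>d. a j * (if j = i then \<alpha> ^ (d - j) * \<delta> ^ j else 0))"
    unfolding form_subst_def by (simp add: coeff_sum)
  also have "\<dots> = (\<Sum>j\<le>d. if j = i then a j * (\<alpha> ^ (d - j) * \<delta> ^ j) else 0)"
    by (intro sum.cong) auto
  finally show ?thesis using assms by (simp add: mult.assoc)
qed

text \<open>
  The one-parameter subgroup \<open>diag (1/w, w)\<close> multiplies \<open>a i\<close> by \<open>w ^ (2 i + 1 - d)\<close> and \<open>b i\<close>
  by \<open>w ^ (2 i - d - 1)\<close>, so the orbit of \<open>(a, b)\<close> has \<open>0\<close> in its closure.
\<close>

lemma unstable_if_vanishing: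
  fixes a b :: "nat \<Rightarrow> 'k::field_char_0"
  assumes a: "\<And>i. i \<le> d \<Longrightarrow> 2 * i + 1 \<le> d \<Longrightarrow> a i = 0"
    and b: "\<And>i. i \<le> d \<Longrightarrow> 2 * i \<le> d + 1 \<Longrightarrow> b i = 0"
  shows "\<not> semistable d (a, b)"
proof
  assume "semistable d (a, b)"
  then obtain m f where m: "m > 0" and f: "hom_polynomial d m f"
    and inv: "\<And>\<alpha> \<beta> \<gamma> \<delta> R. \<alpha> * \<delta> - \<beta> * \<gamma> = 1 \<Longrightarrow> f (conj_act d \<alpha> \<beta> \<gamma> \<delta> R) = f R"
    and nz: "f (a, b) \<noteq> 0"
    unfolding semistable_def by - (elim exE conjE, rule that, auto)
  obtain M c where M: "\<And>e e'. (e, e') \<in> M \<Longrightarrow> (\<Sum>i\<le>d. e i + e' i) = m"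
    and fM: "\<And>a b. f (a, b) = (\<Sum>(e, e')\<in>M. c (e, e') * (\<Prod>i\<le>d. a i ^ e i * b i ^ e' i))"
    using f unfolding hom_polynomial_def by - (elim exE conjE, rule that, auto)
  \<comment> \<open>\<open>f\<close> along the orbit, as a polynomial in \<open>w\<close>. Truncated
    subtraction is harmless: where it would cut off, the coefficient is 0 by hypothesis, and all
    other exponents are positive.\<close>
  define q where "q = (\<Sum>(e, e')\<in>M. smult (c (e, e')) (\<Prod>i\<le>d.
    monom (a i) (2 * i + 1 - d) ^ e i * monom (b i) (2 * i - (d + 1)) ^ e' i))"
  have "poly q w = f (a, b)" if w: "w \<noteq> 0" for w
  proof -
    obtain a' b' where ab': "conj_act d (inverse w) 0 0 w (a, b) = (a', b')" by force
    have "a' i = poly (monom (a i) (2 * i + 1 - d)) w" if "i \<le> d" for i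
    proof (cases "a i = 0")
      case False
      with a[of i] that have "2 * i + 1 = (2 * i + 1 - d) + d" by linarith
      moreover obtain k where "d = i + k" using \<open>i \<le> d\<close> le_Suc_ex by blast
      ultimately have "Suc i = (2 * i + 1 - d) + k" by linarith
      then have "w * w ^ i = w ^ (2 * i + 1 - d) * w ^ k" by (metis power_Suc power_add)
      then have "w * (inverse w ^ k * w ^ i) = w ^ (2 * i + 1 - d)"
        using w by (simp add: field_simps)
      then show ?thesis
        using ab' that \<open>d = i + k\<close> by (auto simp: conj_act_def Let_def form_subst_diag poly_monom mult_ac)
    qed (use ab' that in \<open>auto simp: conj_act_def Let_def form_subst_diag\<close>)
    moreover have "b' i = poly (monom (b i) (2 * i - (d + 1))) w" if "i \<le> d" for i
    proof (cases "b i = 0")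
      case False
      with b[of i] that have "2 * i = (2 * i - (d + 1)) + (d + 1)" by linarith
      moreover obtain k where "d = i + k" using \<open>i \<le> d\<close> le_Suc_ex by blast
      ultimately have "i = (2 * i - (d + 1)) + Suc k" by linarith
      then have "w ^ i = w ^ (2 * i - (d + 1)) * (w * w ^ k)" by (metis power_Suc power_add)
      then have "inverse w * (inverse w ^ k * w ^ i) = w ^ (2 * i - (d + 1))"
        using w by (simp add: field_simps)
      then show ?thesis
        using ab' that \<open>d = i + k\<close> by (auto simp: conj_act_def Let_def form_subst_diag poly_monom mult_ac)
    qed (use ab' that in \<open>auto simp: conj_act_def Let_def form_subst_diag\<close>)
    ultimately have "poly q w = f (a', b')"
      unfolding q_def fM poly_sum by (intro sum.cong) (auto simp: poly_prod)
    also have "\<dots> = f (a, b)"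
      unfolding ab'[symmetric] by (intro inv) (use w in simp)
    finally show ?thesis .
  qed
  \<comment> \<open>Invariance gives agreement at all nonzero \<open>w\<close>; as these are
    infinitely many, the value at the limit \<open>w = 0\<close> agrees too.\<close>
  then have "UNIV - {0} \<subseteq> {w. poly (q - [:f (a, b):]) w = 0}" by auto
  moreover have "infinite (UNIV - {0 :: 'k})" by (simp add: infinite_UNIV_char_0)
  ultimately have "q - [:f (a, b):] = 0"
    using poly_roots_finite finite_subset by metis
  then have "f (a, b) = poly q 0" by simp
  also have "\<dots> = 0"
    unfolding q_def poly_sum
  proof (rule sum.neutral, clarify)
    fix e e' assume "(e, e') \<in> M"
    then have "(\<Sum>i\<le>d. e i + e' i) \<noteq> 0" using M m by simp
    then obtain i where i: "i \<in> {..d}" "e i + e' i \<noteq> 0" by (rule sum.not_neutral_contains_not_neutral)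
    have "poly (monom (a i) (2 * i + 1 - d)) 0 = 0" "poly (monom (b i) (2 * i - (d + 1))) 0 = 0"
      using a[of i] b[of i] i(1) by (auto simp: poly_monom power_0_left)
    then have "poly (monom (a i) (2 * i + 1 - d) ^ e i * monom (b i) (2 * i - (d + 1)) ^ e' i) 0 = 0"
      using i(2) by (auto simp: power_0_left)
    then have "(\<Prod>i\<le>d. poly (monom (a i) (2 * i + 1 - d) ^ e i
        * monom (b i) (2 * i - (d + 1)) ^ e' i) 0) = 0"
      using i(1) by (intro prod_zero) blast+
    then show "poly (smult (c (e, e')) (\<Prod>i\<le>d.
        monom (a i) (2 * i + 1 - d) ^ e i * monom (b i) (2 * i - (d + 1)) ^ e' i)) 0 = 0"
      unfolding poly_smult poly_prod by simp
  qed
  finally show False using nz by simp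
qed

section \<open>Moving a multiple point of the forms to \<open>[1, 0]\<close>\<close>

definition form_poly :: "nat \<Rightarrow> (nat \<Rightarrow> 'a::comm_ring_1) \<Rightarrow> 'a poly" where
  "form_poly d a = (\<Sum>i\<le>d. monom (a i) (d - i))"

lemma pcompose_power: "pcompose (p ^ k) q = pcompose p q ^ k"
  for p q :: "'a::comm_ring_1 poly"
  by (induction k) (simp_all add: pcompose_mult pcompose_1)

text \<open>The matrix has determinant 1 and sends \<open>[1, 0]\<close> to \<open>[l, 1]\<close>,
  so low coefficients of the new form measure the vanishing at \<open>x = l\<close>.
  \<open>form_poly\<close> sets \<open>Y = 1\<close> but \<open>form_subst\<close> sets
  \<open>X = 1\<close>, and \<open>F (Y - l, - 1) = (- 1)^d F (l - Y, 1)\<close>.\<close>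

lemma form_subst_reflection:
  "form_subst d (- l) 1 (- 1) 0 a i = (- 1) ^ d * coeff (pcompose (form_poly d a) [:l, - 1:]) i"
proof -
  have "smult (a j) ([:- l, 1:] ^ (d - j) * [:- 1, 0:] ^ j)
      = smult ((- 1) ^ d) (pcompose (monom (a j) (d - j)) [:l, - 1:])" if "j \<le> d" for j
  proof -
    have "[:- 1, 0 :: 'a:] ^ j = [:(- 1) ^ j:]" by (simp add: poly_const_pow)
    moreover have "[:- l, 1:] = smult (- 1) [:l, - 1:]" by simp
    then have "[:- l, 1:] ^ (d - j) = smult ((- 1) ^ (d - j)) ([:l, - 1:] ^ (d - j))"
      by (simp only: smult_power)
    moreover have "(- 1) ^ j * (- 1) ^ (d - j) = (- 1 :: 'a) ^ d"
      using that by (simp flip: power_add)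
    moreover have "pcompose (monom (a j) (d - j)) [:l, - 1:] = smult (a j) ([:l, - 1:] ^ (d - j))"
      by (simp add: monom_altdef pcompose_smult pcompose_power pcompose_pCons)
    ultimately show ?thesis by (simp add: mult_ac)
  qed
  then have "form_subst d (- l) 1 (- 1) 0 a i
      = coeff (\<Sum>j\<le>d. smult ((- 1) ^ d) (pcompose (monom (a j) (d - j)) [:l, - 1:])) i"
    unfolding form_subst_def by (intro arg_cong[of _ _ "\<lambda>P. coeff P i"] sum.cong) auto
  then show ?thesis
    unfolding form_poly_def by (simp add: pcompose_sum coeff_sum sum_distrib_left)
qed

text \<open>Conjugation moves the target along with the source: up to substitution the new pair is
  \<open>- F_b\<close> and \<open>F_a - l F_b\<close>. Their orders at the new base point are at
  least \<open>n (n - 1)\<close> and \<open>n^2\<close>, beyond the bounds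
  \<open>(n^2 - 1) / 2\<close> and \<open>(n^2 + 1) / 2\<close>.\<close>

lemma unstable_if_divisible:
  fixes a b :: "nat \<Rightarrow> 'k::field_char_0"
  assumes n: "n \<ge> 2"
    and F: "form_poly (n ^ 2) a - smult l (form_poly (n ^ 2) b) = [:- l, 1:] ^ n ^ 2 * g"
    and G: "form_poly (n ^ 2) b = [:- l, 1:] ^ (n * (n - 1)) * h"
  shows "\<not> semistable (n ^ 2) (a, b)"
proof
  assume "semistable (n ^ 2) (a, b)"
  then have ss: "semistable (n ^ 2) (conj_act (n ^ 2) (- l) 1 (- 1) 0 (a, b))"
    by (rule semistable_conj_act) simp
  let ?r = "\<lambda>P. pcompose P [:l, - 1:]"
  have pow: "?r ([:- l, 1:] ^ k * f) = monom ((- 1) ^ k) k * ?r f" for k f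
    by (simp add: pcompose_mult pcompose_power pcompose_pCons monom_altdef smult_power[symmetric])
  have low: "coeff (?r ([:- l, 1:] ^ k * f)) i = 0" if "i < k" for i k f
    unfolding pow using that by (simp add: coeff_monom_mult)
  have n_sq: "n ^ 2 = n * (n - 1) + n" using n by (simp add: power2_eq_square algebra_simps)
  have "\<not> semistable (n ^ 2) (\<lambda>i. - form_subst (n ^ 2) (- l) 1 (- 1) 0 b i,
    \<lambda>i. form_subst (n ^ 2) (- l) 1 (- 1) 0 a i - l * form_subst (n ^ 2) (- l) 1 (- 1) 0 b i)"
  proof (rule unstable_if_vanishing)
    fix i assume "2 * i + 1 \<le> n ^ 2"
    \<comment> \<open>Together with \<open>n_sq\<close> this gives
      \<open>2 i + 1 \<le> 2 n (n - 1)\<close>; it is false for \<open>n = 1\<close>.\<close>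
    moreover have "n \<le> n * (n - 1)" using n by simp
    ultimately have "i < n * (n - 1)" using n_sq by linarith
    then show "- form_subst (n ^ 2) (- l) 1 (- 1) 0 b i = 0"
      unfolding form_subst_reflection G by (simp only: low mult_zero_right minus_zero)
  next
    fix i assume "2 * i \<le> n ^ 2 + 1"
    moreover have "n * 2 \<le> n ^ 2" using n by (simp add: power2_eq_square)
    ultimately have "i < n ^ 2" using n by linarith
    have "form_subst (n ^ 2) (- l) 1 (- 1) 0 a i - l * form_subst (n ^ 2) (- l) 1 (- 1) 0 b i
      = (- 1) ^ n ^ 2 * coeff (?r (form_poly (n ^ 2) a - smult l (form_poly (n ^ 2) b))) i"
      by (simp add: form_subst_reflection pcompose_diff pcompose_smult algebra_simps)
    also have "\<dots> = 0" unfolding F using \<open>i < n ^ 2\<close> by (simp only: low mult_zero_right)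
    finally show "form_subst (n ^ 2) (- l) 1 (- 1) 0 a i
      - l * form_subst (n ^ 2) (- l) 1 (- 1) 0 b i = 0" .
  qed
  then show False using ss by (simp add: conj_act_def Let_def)
qed

section \<open>Reduction of the Lattes map\<close>

lemma (in embedded_field) ev_form_poly: "ev x (form_poly d a) = form_eval d (\<lambda>i. \<iota> (a i)) x 1"
  by (simp add: form_poly_def form_eval_def ev_sum)

lemma field_embedding_to_ac: "field_embedding to_ac"
  by (simp add: field_embedding_def)

text \<open>The classical Bezout identity between \<open>x^4 - 2 A x^2 - 8 B x + A^2\<close> and
  \<open>4 (x^3 + A x + B)\<close>. The terms in \<open>lam\<close> appear because the numerator of
  x is that of z plus \<open>lam\<close> times the denominator.\<close>

lemma duplication_coprime:
  fixes z :: "'a::comm_ring_1"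
  assumes "a2 = 3 * lam" "a4 = 3 * lam ^ 2 + A" "a6 = lam ^ 3 + A * lam + B" and x: "x = z + lam"
  shows "(12 * x ^ 2 + 16 * A) * prod_num a2 a4 a6 z z 1
    + ((12 * x ^ 2 + 16 * A) * lam - (3 * x ^ 3 - 5 * A * x - 27 * B)) * sum_num a2 a4 a6 z z 1
    = 4 * (4 * A ^ 3 + 27 * B ^ 2)"
proof -
  let ?P = "prod_num a2 a4 a6 z z 1" and ?S = "sum_num a2 a4 a6 z z 1"
  have z: "z = x - lam" by (simp add: x)
  have S: "?S = 4 * (x ^ 3 + A * x + B)"
    unfolding sum_num_def assms(1-3) z by (simp add: algebra_simps eval_nat_numeral)
  have P: "?P + lam * ?S = x ^ 4 - 2 * A * x ^ 2 - 8 * B * x + A ^ 2"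
    unfolding S unfolding prod_num_def assms(1-3) z by (simp add: algebra_simps eval_nat_numeral)
  have "(12 * x ^ 2 + 16 * A) * ?P
      + ((12 * x ^ 2 + 16 * A) * lam - (3 * x ^ 3 - 5 * A * x - 27 * B)) * ?S
      = (12 * x ^ 2 + 16 * A) * (?P + lam * ?S) - (3 * x ^ 3 - 5 * A * x - 27 * B) * ?S"
    by (simp add: algebra_simps)
  also have "\<dots> = 4 * (4 * A ^ 3 + 27 * B ^ 2)"
    unfolding P unfolding S by (simp add: algebra_simps eval_nat_numeral)
  finally show ?thesis .
qed

context curve_place
begin

lemma poly_red_pcompose:
  assumes Q: "poly_red Q Q'"
  shows "poly_red F P \<Longrightarrow> poly_red (pcompose F Q) (pcompose P Q')"
proof (induction F arbitrary: P)
  case 0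
  then show ?case using poly_red_unique[OF poly_red_0] by fastforce
next
  case (pCons f F)
  obtain c P' where P: "P = pCons c P'" by (rule pCons_cases)
  have "red f c" "poly_red F P'"
    using pCons.prems unfolding P poly_red_def by (metis coeff_pCons_0, metis coeff_pCons_Suc)
  then show ?case
    unfolding P pcompose_pCons using pCons.IH Q by (intro poly_red_intros)
qed

lemma poly_red_form_poly:
  "(\<And>i. i \<le> d \<Longrightarrow> red (a i) (c i)) \<Longrightarrow> poly_red (form_poly d a) (form_poly d c)"
  unfolding poly_red_def form_poly_def coeff_sum by (intro allI red_sum) auto

end

context nodal_reduction
begin

text \<open>Both quotients agree at almost all geometric points. As \<open>num n\<close> and
  \<open>den n\<close> are coprime and the forms have no common zero, the two representations differ
  by a constant.\<close>

lemma lattes_map_num_den: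
  assumes a: "a2 = 3 * lam" "a4 = 3 * lam ^ 2 + A" "a6 = lam ^ 3 + A * lam + B"
    and lattes: "is_lattes_map A B n a b" and n: "n \<ge> 2"
  defines "G \<equiv> pcompose (form_poly (n ^ 2) a - smult lam (form_poly (n ^ 2) b)) [:lam, 1:]"
    and "H \<equiv> pcompose (form_poly (n ^ 2) b) [:lam, 1:]"
  shows "\<exists>c. G = num n * [:c:] \<and> H = den n * [:c:]"
proof -
  interpret ac: embedded_field "to_ac :: 'f \<Rightarrow> 'f alg_closure"
    using field_embedding_to_ac by unfold_locales
  have ev_X: "ac.ev z [:0, 1:] = z" and ev_C: "ac.ev z [:c:] = to_ac c" for z c
    by simp_all
  have ev_mult_map: "ac.ev z (prodp t w) = prod_num (to_ac a2) (to_ac a4) (to_ac a6) z (ac.ev z t) (ac.ev z w)"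
    "ac.ev z (sump t w) = sum_num (to_ac a2) (to_ac a4) (to_ac a6) z (ac.ev z t) (ac.ev z w)"
    "ac.ev z (diffp t w) = diff_sq z (ac.ev z t) (ac.ev z w)" for z t w
    by (simp_all only: prod_num_def sum_num_def diff_sq_def ac.ev_add ac.ev_mult ac.ev_diff
        ac.ev_power ac.ev_numeral ev_X ev_C)
  have GH: "ac.ev z G = form_eval (n ^ 2) (\<lambda>i. to_ac (a i)) (z + to_ac lam) 1
      - to_ac lam * form_eval (n ^ 2) (\<lambda>i. to_ac (b i)) (z + to_ac lam) 1"
    "ac.ev z H = form_eval (n ^ 2) (\<lambda>i. to_ac (b i)) (z + to_ac lam) 1" for z
    by (simp_all add: G_def H_def ac.ev_pcompose ac.ev_form_poly add.commute)
  have inf: "infinite (UNIV :: 'f alg_closure set)"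
  proof -
    have "inj (\<lambda>k::nat. of_nat k :: 'f alg_closure)"
    proof (rule injI)
      fix j k :: nat
      assume "of_nat j = (of_nat k :: 'f alg_closure)"
      then have "to_ac (\<iota> (of_nat j - of_nat k)) = (0 :: 'f alg_closure)" by simp
      then have "of_nat j - of_nat k = (0 :: 'k)" unfolding ac.emb_eq_0_iff emb_eq_0_iff .
      then show "j = k" by simp
    qed
    then show ?thesis using finite_imageD finite_subset infinite_UNIV_nat subset_UNIV by metis
  qed
  have zero: "P = 0" if "\<And>z. ac.ev z P = 0" for P
  proof -
    have "{z. poly (map_poly to_ac P) z = 0} = (UNIV :: 'f alg_closure set)"
      using that by (simp add: ac.ev_def)
    then have "map_poly to_ac P = (0 :: 'f alg_closure poly)"
      using inf poly_roots_finite by metis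
    then show "P = 0" by (simp add: poly_eq_iff coeff_map_poly)
  qed
  \<comment> \<open>The product disposes of the abscissas at which some multiple up to
    \<open>n\<close> is the point at infinity, so the identity can be checked at every
    \<open>z\<close>.\<close>
  have "(G * den n - H * num n) * (\<Prod>m\<in>{1..n}. den m) = 0"
  proof (rule zero)
    fix z :: "'f alg_closure"
    show "ac.ev z ((G * den n - H * num n) * (\<Prod>m\<in>{1..n}. den m)) = 0"
    proof (cases "\<exists>m\<in>{1..n}. ac.ev z (den m) = 0")
      case True
      then show ?thesis by (simp add: ac.ev_prod prod_zero_iff)
    next
      case False
      define x where "x = z + to_ac lam"
      obtain y where y: "y ^ 2 = x ^ 3 + to_ac A * x + to_ac B"
        using nth_root_exists[of 2] by auto
      have "\<exists>X1 Y1. ec_mult (to_ac A) n (Affine x y) = Affine X1 Y1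
        \<and> (X1 - to_ac lam) * ac.ev z (den n) = ac.ev z (num n)"
      proof (rule ec_mult_coordinate[OF y _ _ _ x_def])
        show "to_ac a2 = 3 * to_ac lam" "to_ac a4 = 3 * to_ac lam ^ 2 + to_ac A"
          "to_ac a6 = to_ac lam ^ 3 + to_ac A * to_ac lam + to_ac B"
          using a by simp_all
        show "ac.ev z (num 1) = z" "ac.ev z (den 1) = 1"
          by (simp_all add: num_def den_def)
        show "ac.ev z (num 2) = prod_num (to_ac a2) (to_ac a4) (to_ac a6) z z 1"
          "ac.ev z (den 2) = sum_num (to_ac a2) (to_ac a4) (to_ac a6) z z 1"
          by (simp_all add: num_def den_def numeral_2_eq_2 ev_mult_map)
        show "ac.ev z (den (Suc (Suc m))) * ac.ev z (den m)
            = diff_sq z (ac.ev z (num (Suc m))) (ac.ev z (den (Suc m)))" if "m \<ge> 1" for m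
          using arg_cong[OF den_Suc_Suc[OF that], of "ac.ev z"] by (simp add: ev_mult_map)
        show "ac.ev z (num (Suc (Suc m))) * ac.ev z (den m) + ac.ev z (num m) * ac.ev z (den (Suc (Suc m)))
            = sum_num (to_ac a2) (to_ac a4) (to_ac a6) z (ac.ev z (num (Suc m))) (ac.ev z (den (Suc m)))"
          if "m \<ge> 1" for m
          using arg_cong[OF num_Suc_Suc[OF that], of "ac.ev z"] by (simp add: ev_mult_map)
      qed (use False n in auto)
      then obtain X1 Y1 where X1: "ec_mult (to_ac A) n (Affine x y) = Affine X1 Y1"
        "(X1 - to_ac lam) * ac.ev z (den n) = ac.ev z (num n)"
        by blast
      have "Affine x y \<in> ec_points (to_ac A) (to_ac B)" using y by (simp add: ec_points_def)
      then obtain c where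
        "form_eval (n ^ 2) (\<lambda>i. to_ac (a i)) x 1 = c * X1"
        "form_eval (n ^ 2) (\<lambda>i. to_ac (b i)) x 1 = c"
        using lattes X1(1) unfolding is_lattes_map_def by fastforce
      then have "ac.ev z G * ac.ev z (den n) = ac.ev z H * ac.ev z (num n)"
        unfolding GH x_def[symmetric] X1(2)[symmetric] by (simp add: algebra_simps)
      then show ?thesis by simp
    qed
  qed
  moreover have "den m \<noteq> 0" if "m \<in> {1..n}" for m
    using that good_not_0(2)[OF num_den_good] by simp
  ultimately have eq: "G * den n = H * num n" by (simp add: prod_zero_iff)
  obtain u v where uv: "u * num n + v * den n = 1"
    using num_den_good[of n] n by (auto simp: good_def)
  define h where "h = u * G + v * H"
  have G: "G = num n * h"
  proof -
    have "G = G * (u * num n + v * den n)" using uv by simp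
    also have "\<dots> = u * num n * G + v * (G * den n)" by (simp add: algebra_simps)
    finally show ?thesis unfolding eq h_def by (simp add: algebra_simps)
  qed
  have H: "H = den n * h"
  proof -
    have "H = H * (u * num n + v * den n)" using uv by simp
    also have "\<dots> = u * (H * num n) + v * den n * H" by (simp add: algebra_simps)
    finally show ?thesis unfolding eq[symmetric] h_def by (simp add: algebra_simps)
  qed
  \<comment> \<open>A root of \<open>h\<close> would be a common zero of the two forms, against
    \<open>P1_morphism\<close>.\<close>
  have "degree h = 0"
  proof (rule ccontr)
    assume "degree h \<noteq> 0"
    then have "degree (map_poly to_ac h :: 'f alg_closure poly) > 0"
      by (simp add: degree_map_poly)
    then obtain z where "ac.ev z h = 0"
      using alg_closed_imp_poly_has_root unfolding ac.ev_def by blast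
    then have "ac.ev z G = 0" "ac.ev z H = 0" unfolding G H by simp_all
    then have "form_eval (n ^ 2) (\<lambda>i. to_ac (a i)) (z + to_ac lam) 1 = 0"
      "form_eval (n ^ 2) (\<lambda>i. to_ac (b i)) (z + to_ac lam) 1 = 0"
      unfolding GH by simp_all
    then show False using lattes unfolding is_lattes_map_def P1_morphism_def by force
  qed
  then show ?thesis using G H by (metis degree_eq_zeroE)
qed

lemma lattes_map_reduction:
  assumes a: "a2 = 3 * \<iota> l" "a4 = 3 * \<iota> l ^ 2 + A" "a6 = \<iota> l ^ 3 + A * \<iota> l + B"
    and lattes: "is_lattes_map A B n a b" and n: "n \<ge> 2"
    and c: "\<And>i. i \<le> n ^ 2 \<Longrightarrow> red (a i) (c i)" and d: "\<And>i. i \<le> n ^ 2 \<Longrightarrow> red (b i) (d i)"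
  shows "\<not> semistable (n ^ 2) (c, d)"
proof -
  let ?G = "form_poly (n ^ 2) c - smult l (form_poly (n ^ 2) d)"
  let ?H = "form_poly (n ^ 2) d"
  obtain e where
    e: "pcompose (form_poly (n ^ 2) a - smult (\<iota> l) (form_poly (n ^ 2) b)) [:\<iota> l, 1:] = num n * [:e:]"
      "pcompose (form_poly (n ^ 2) b) [:\<iota> l, 1:] = den n * [:e:]"
    using lattes_map_num_den[OF a lattes n] by blast
  obtain W where num: "poly_red (num n) ([:0, 1:] ^ n ^ 2)"
    and W: "poly_red (den n) W" "W \<noteq> 0" "order 0 W = n * (n - 1)"
    using num_den_good[of n] n by (auto simp: good_def)
  have H: "poly_red (pcompose (form_poly (n ^ 2) b) [:\<iota> l, 1:]) (pcompose ?H [:l, 1:])"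
    by (intro poly_red_pcompose poly_red_form_poly d poly_red_intros red_const red_1)
  have G: "poly_red (num n * [:e:]) (pcompose ?G [:l, 1:])"
    unfolding e(1)[symmetric]
    by (intro poly_red_pcompose poly_red_form_poly c d poly_red_diff poly_red_smult
        poly_red_pCons poly_red_0 red_const red_1)
  \<comment> \<open>The constant \<open>e\<close> is a priori only in K; since \<open>num n\<close>
    is primitive, integrality of the product forces integrality of \<open>e\<close>.\<close>
  then obtain q where q: "poly_red [:e:] q" "[:0, 1:] ^ n ^ 2 * q = pcompose ?G [:l, 1:]"
    using poly_red_cancel[OF num _ G] by auto
  have "pcompose ?H [:l, 1:] = W * q"
    using H poly_red_mult[OF W(1) q(1)] unfolding e(2) by (rule poly_red_unique)
  moreover obtain g where "W = [:0, 1:] ^ (n * (n - 1)) * g"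
    using order_decomp[OF W(2), of 0] W(3) by auto
  ultimately have H': "pcompose ?H [:l, 1:] = [:0, 1:] ^ (n * (n - 1)) * (g * q)"
    by (simp add: mult.assoc)
  have unshift: "pcompose (pcompose P [:l, 1:]) [:- l, 1:] = P" for P
    by (simp add: pcompose_pCons flip: pcompose_assoc)
  have X: "pcompose ([:0, 1:] ^ k * P) [:- l, 1:] = [:- l, 1:] ^ k * pcompose P [:- l, 1:]" for k P
    by (simp add: pcompose_mult pcompose_power pcompose_pCons)
  show ?thesis
  proof (rule unstable_if_divisible[OF n])
    show "?G = [:- l, 1:] ^ n ^ 2 * pcompose q [:- l, 1:]"
      unfolding X[symmetric] q(2) unshift ..
    show "?H = [:- l, 1:] ^ (n * (n - 1)) * pcompose (g * q) [:- l, 1:]"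
      unfolding X[symmetric] H'[symmetric] unshift ..
  qed
qed

end

theorem mainTheorem4:
  fixes \<iota> :: "'k::{alg_closed_field, field_char_0} \<Rightarrow> 'f::field"
    and C :: "('f \<Rightarrow> int) set"
    and p :: "'f \<Rightarrow> int"
    and A B :: 'f
    and lam1 lam2 :: 'k
    and n :: nat
    and a b :: "nat \<Rightarrow> 'f"
  assumes "smooth_curve \<iota> C"
    and "elliptic_curve A B"
    and "p \<in> C"
    and "A \<in> local_ring p" and "B \<in> local_ring p"
    and "[:value_at \<iota> p B, value_at \<iota> p A, 0, 1:] = [:- lam1, 1:] * [:- lam2, 1:] ^ 2"
    and "lam1 \<noteq> lam2"
    and "n \<ge> 2"
    and "is_lattes_map A B n a b"
    and "normalised_at p (n ^ 2) a b"
  shows "\<not> semistable (n ^ 2) (\<lambda>i. value_at \<iota> p (a i), \<lambda>i. value_at \<iota> p (b i))"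
proof -
  have ff: "function_field \<iota>" and "p \<in> places \<iota>"
    using assms(1,3) by (auto simp: smooth_curve_def)
  then interpret curve_place \<iota> p
    by unfold_locales (auto simp: function_field_def)
  interpret curve_point \<iota> p
    by unfold_locales (use residue_exists[OF ff] in \<open>auto simp: red_def\<close>)
  have val: "red f (value_at \<iota> p f)" if "f \<in> local_ring p" for f
    using residue[OF that] value_at_eq by metis
  define vA vB where "vA = value_at \<iota> p A" and "vB = value_at \<iota> p B"
  have red: "red A vA" "red B vB"
    unfolding vA_def vB_def by (intro val assms)+
  have "[:vB, vA, 0, 1:] = [:- (lam1 * lam2 ^ 2), lam2 ^ 2 + 2 * lam1 * lam2, - lam1 - 2 * lam2, 1:]"
    using assms(6) unfolding vA_def vB_def by (simp add: power2_eq_square algebra_simps)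
  \<comment> \<open>The absent quadratic term forces \<open>lam1 = - 2 * lam2\<close>. In the
    coordinate z the simple root is \<open>lam1 - lam2 = - 3 * lam2\<close>, hence the value
    \<open>3 * lam2\<close> for \<open>\<mu>\<close>, nonzero because the roots differ.\<close>
  then have lam: "lam1 = - 2 * lam2" and vAB: "vA = lam2 ^ 2 + 2 * lam1 * lam2" "vB = - (lam1 * lam2 ^ 2)"
    by (auto simp: algebra_simps add_eq_0_iff)
  define lam where "lam = \<iota> lam2"
  have lam_red: "red lam lam2" unfolding lam_def by simp
  \<comment> \<open>The Taylor coefficients of \<open>x^3 + A x + B\<close> at \<open>lam\<close>;
    the last two reduce to 0 because \<open>lam2\<close> is a double root.\<close>
  interpret nodal_reduction \<iota> p "3 * lam" "3 * lam ^ 2 + A" "lam ^ 3 + A * lam + B" "3 * lam2"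
  proof
    show "red (3 * lam) (3 * lam2)" by (intro red_mult red_numeral lam_red)
    have "red (3 * (lam * lam) + A) (3 * (lam2 * lam2) + vA)"
      by (intro red_mult red_add red_numeral lam_red red)
    then show "red (3 * lam ^ 2 + A) 0"
      unfolding vAB lam by (simp add: power2_eq_square algebra_simps)
    have "red (lam * lam * lam + A * lam + B) (lam2 * lam2 * lam2 + vA * lam2 + vB)"
      by (intro red_mult red_add red_numeral lam_red red)
    then show "red (lam ^ 3 + A * lam + B) 0"
      unfolding vAB lam by (simp add: power2_eq_square power3_eq_cube algebra_simps)
    show "3 * lam2 \<noteq> 0" using lam assms(7) by auto
    define D where "D = 4 * (4 * A ^ 3 + 27 * B ^ 2)"
    have "4 = \<iota> 4" by simp
    then have "D \<noteq> 0"
      using assms(2) unfolding D_def elliptic_curve_def by (metis emb_eq_0_iff mult_eq_0_iff zero_neq_numeral)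
    let ?a2 = "[:3 * lam:]" and ?a4 = "[:3 * lam ^ 2 + A:]" and ?a6 = "[:lam ^ 3 + A * lam + B:]"
    let ?z = "[:0, 1:]"
    have "?a2 = 3 * [:lam:]" "?a4 = 3 * [:lam:] ^ 2 + [:A:]" "?a6 = [:lam:] ^ 3 + [:A:] * [:lam:] + [:B:]"
      by (simp_all add: numeral_poly poly_const_pow)
    from duplication_coprime[OF this refl, of ?z]
    obtain \<alpha> \<beta> where "\<alpha> * prod_num ?a2 ?a4 ?a6 ?z ?z 1 + \<beta> * sum_num ?a2 ?a4 ?a6 ?z ?z 1
      = 4 * (4 * [:A:] ^ 3 + 27 * [:B:] ^ 2)"
      by blast
    moreover have "4 * (4 * [:A:] ^ 3 + 27 * [:B:] ^ 2) = [:D:]"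
      by (simp add: D_def numeral_poly poly_const_pow)
    \<comment> \<open>The inverse is taken in K. \<open>D\<close> vanishes at p because the reduced
      curve is singular, so this identity cannot be reduced.\<close>
    ultimately have "[:inverse D:] * (\<alpha> * prod_num ?a2 ?a4 ?a6 ?z ?z 1 + \<beta> * sum_num ?a2 ?a4 ?a6 ?z ?z 1) = 1"
      using \<open>D \<noteq> 0\<close> by (simp add: one_pCons)
    then show "\<exists>\<alpha> \<beta>. \<alpha> * prod_num ?a2 ?a4 ?a6 ?z ?z 1 + \<beta> * sum_num ?a2 ?a4 ?a6 ?z ?z 1 = 1"
      by (intro exI[of _ "[:inverse D:] * \<alpha>"] exI[of _ "[:inverse D:] * \<beta>"])
        (simp only: distrib_left mult.assoc)
  qed
  show ?thesis
    using assms(10)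
    by (intro lattes_map_reduction[OF _ _ _ assms(9,8), of lam2])
      (auto simp: lam_def normalised_at_def intro!: val)
qed

end
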